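(* Let $M=(V,d)$ be a metric space with $|V|=n$ points, whose minimum nonzero distance is $1$ and whose diameter is $\Delta$. Then for every $t\in\mathbb{N}$, $M$ is $O\bigl(t\cdot\min\{\log \Delta,\log n\}\bigr)$ path embedded (with an absolute constant in the $O(\cdot)$) into an efficiently constructible ultrametric with $\Gamma\le n^{\beta}$ points, where \[ \beta=\min\Bigl\{(\log n)^{1/t},\ \bigl[t\log(4\Delta)\bigr]^{2/t}\Bigr\}. \]
   Context: An ultrametric is a metric space defined on the leaves of a finite rooted tree $T$ in which every vertex $u$ carries a label $\Delta(u)\ge 0$, with $\Delta(u)=0$ iff $u$ is a leaf, and $\Delta(v)\le\Delta(u)$ whenever $v$ is a child of $u$; the distance between leaves $x,y$ is $\Delta(\mathrm{lca}(x,y))$. A multi-embedding of a metric space $M$ in a metric space $N$ is a partial surjective function $f$ from (the points of) $N$ onto (the points of) $M$; the points of $f^{-1}(x)$ are the representatives of $x$. It is non-contractive if $d_N(u,v)\ge d_M(f(u),f(v))$ for all $u,v$ in the domain of $f$. A path in a metric space is a finite sequence of points $p=\langle u_1,\dots,u_m\rangle$, with length $\ell(p)=\sum_{i=1}^{m-1}d(u_i,u_{i+1})$. A non-contractive multi-embedding $f$ has path distortion at most $\alpha$ (and $M$ is then said to be $\alpha$ path embedded in $N$) if for every path $p=\langle u_1,\dots,u_m\rangle$ in $M$ there is a path $p'=\langle u'_1,\dots,u'_m\rangle$ in $N$ with $f(u'_i)=u_i$ for all $i$ and $\ell(p')\le\alpha\,\ell(p)$. The size of the target is the number of its points. Logarithms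 are base 2.
   Formalization: The distortion bound is O(t·max{1, min{log Δ, log n}}) in place of O(t·min{log Δ, log n}): the latter is 0 for Δ = 1 and tends to 0 as Δ → 1, while a non-contractive embedding has path distortion at least 1; for Δ ≥ 2 the two agree. *)

theory Defs
  imports "HOL-Analysis.Analysis"
begin

section \<open>Diameter and smallest nonzero distance of a finite metric space\<close>

definition diam :: "'a set \<Rightarrow> ('a \<Rightarrow> 'a \<Rightarrow> real) \<Rightarrow> real" where
  "diam V d = Max {d x y |x y. x \<in> V \<and> y \<in> V}"

definition min_nonzero_dist :: "'a set \<Rightarrow> ('a \<Rightarrow> 'a \<Rightarrow> real) \<Rightarrow> real" where
  "min_nonzero_dist V d = Min {d x y |x y. x \<in> V \<and> y \<in> V \<and> d x y \<noteq> 0}"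


section \<open>Multi-embeddings and path distortion\<close>

text \<open>A partial function from \<open>N\<close> onto \<open>V\<close> is a map \<open>f\<close> with \<open>dom f \<subseteq> N\<close> and \<open>ran f = V\<close>;
  the representatives of \<open>x\<close> are the points \<open>u\<close> with \<open>f u = Some x\<close>.\<close>

definition multi_embedding :: "'a set \<Rightarrow> 'b set \<Rightarrow> ('b \<rightharpoonup> 'a) \<Rightarrow> bool" where
  "multi_embedding V N f \<longleftrightarrow> dom f \<subseteq> N \<and> ran f = V"

definition non_contractive ::
  "('a \<Rightarrow> 'a \<Rightarrow> real) \<Rightarrow> ('b \<Rightarrow> 'b \<Rightarrow> real) \<Rightarrow> ('b \<rightharpoonup> 'a) \<Rightarrow> bool" where
  "non_contractive d \<rho> f \<longleftrightarrow>
     (\<forall>u\<in>dom f. \<forall>v\<in>dom f. d (the (f u)) (the (f v)) \<le> \<rho> u v)"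

definition path_length :: "('a \<Rightarrow> 'a \<Rightarrow> real) \<Rightarrow> 'a list \<Rightarrow> real" where
  "path_length d p = (\<Sum>i<length p - 1. d (p ! i) (p ! Suc i))"

definition path_distortion_le ::
  "'a set \<Rightarrow> ('a \<Rightarrow> 'a \<Rightarrow> real) \<Rightarrow> 'b set \<Rightarrow> ('b \<Rightarrow> 'b \<Rightarrow> real) \<Rightarrow> ('b \<rightharpoonup> 'a) \<Rightarrow> real \<Rightarrow> bool" where
  "path_distortion_le V d N \<rho> f \<alpha> \<longleftrightarrow>
     (\<forall>p. set p \<subseteq> V \<longrightarrow>
        (\<exists>p'. set p' \<subseteq> N \<and> length p' = length p \<and>
              (\<forall>i<length p. f (p' ! i) = Some (p ! i)) \<and>
              path_length \<rho> p' \<le> \<alpha> * path_length d p))"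

definition path_embedding ::
  "'a set \<Rightarrow> ('a \<Rightarrow> 'a \<Rightarrow> real) \<Rightarrow> 'b set \<Rightarrow> ('b \<Rightarrow> 'b \<Rightarrow> real) \<Rightarrow> real \<Rightarrow> ('b \<rightharpoonup> 'a) \<Rightarrow> bool" where
  "path_embedding V d N \<rho> \<alpha> f \<longleftrightarrow>
     multi_embedding V N f \<and> non_contractive d \<rho> f \<and> path_distortion_le V d N \<rho> f \<alpha>"


section \<open>Ultrametrics as labelled trees\<close>

text \<open>A leaf carries the point it represents (and, implicitly, the label 0); an inner vertex
  carries its label and the list of subtrees rooted at its children.\<close>

datatype 'b ltree = Leaf 'b | Node real "'b ltree list"

primrec label :: "'b ltree \<Rightarrow> real" where
  "label (Leaf p) = 0"
| "label (Node D ts) = D"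

primrec leaves :: "'b ltree \<Rightarrow> 'b list" where
  "leaves (Leaf p) = [p]"
| "leaves (Node D ts) = concat (map leaves ts)"

lemma size_in_ltrees [termination_simp]: "s \<in> set ts \<Longrightarrow> size s < Suc (size_list size ts)"
  by (induction ts) auto

fun wf_labels :: "'b ltree \<Rightarrow> bool" where
  "wf_labels (Leaf p) \<longleftrightarrow> True"
| "wf_labels (Node D ts) \<longleftrightarrow>
     ts \<noteq> [] \<and> 0 < D \<and> (\<forall>s\<in>set ts. label s \<le> D \<and> wf_labels s)"

definition ultrametric_tree :: "'b ltree \<Rightarrow> bool" where
  "ultrametric_tree T \<longleftrightarrow> wf_labels T \<and> distinct (leaves T)"

lemma size_find_ltrees [termination_simp]:
  "find Q ts = Some s \<Longrightarrow> size s < Suc (size_list size ts)"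
  by (auto simp: find_Some_iff intro!: size_in_ltrees)

text \<open>The vertices of a tree are represented by the subtrees hanging from them.\<close>

fun lca :: "'b ltree \<Rightarrow> 'b \<Rightarrow> 'b \<Rightarrow> 'b ltree" where
  "lca (Leaf p) x y = Leaf p"
| "lca (Node D ts) x y =
     (case find (\<lambda>s. x \<in> set (leaves s) \<and> y \<in> set (leaves s)) ts of
        None \<Rightarrow> Node D ts
      | Some s \<Rightarrow> lca s x y)"

definition tree_points :: "'b ltree \<Rightarrow> 'b set" where
  "tree_points T = set (leaves T)"

definition tree_dist :: "'b ltree \<Rightarrow> 'b \<Rightarrow> 'b \<Rightarrow> real" where
  "tree_dist T x y = label (lca T x y)"


section \<open>Efficient constructibility\<close>

text \<open>The machine model is a uniform, unit-cost model of exact real computation (a real RAM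
  with pairs in place of addressable memory): a program is a finite list of first-order,
  mutually recursive function bodies, working on real numbers and pairs. The primitive
  operations on numbers are the four field operations and comparison, and the only numeric
  constants are integers. Variables are de Bruijn indices into the environment, and each
  function takes one argument.\<close>

datatype val = RealV real | PairV val val

datatype arith = Plus | Minus | Times | Divide

datatype expr =
    Var nat
  | Lit int
  | Arith arith expr expr
  | IfLe expr expr expr expr
  | MkPair expr expr
  | Fst expr
  | Snd expr
  | IfPair expr expr expr
  | LetIn expr expr
  | Call nat expr

type_synonym program = "expr list"

fun apply_arith :: "arith \<Rightarrow> real \<Rightarrow> real \<Rightarrow> real" where
  "apply_arith Plus a b = a + b"
| "apply_arith Minus a b = a - b"
| "apply_arith Times a b = a * b"
| "apply_arith Divide a b = a / b"

text \<open>\<open>eval P E e v k\<close>: in the environment \<open>E\<close> the expression \<open>e\<close> evaluates to \<open>v\<close> in \<open>k\<close> steps.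
  Type errors and divisions by zero have no derivation.\<close>

inductive eval :: "program \<Rightarrow> val list \<Rightarrow> expr \<Rightarrow> val \<Rightarrow> nat \<Rightarrow> bool" for P :: program where
  eval_Var: "i < length E \<Longrightarrow> eval P E (Var i) (E ! i) 1"
| eval_Lit: "eval P E (Lit z) (RealV (of_int z)) 1"
| eval_Arith: "\<lbrakk>eval P E e1 (RealV a) k1; eval P E e2 (RealV b) k2; q = Divide \<longrightarrow> b \<noteq> 0\<rbrakk>
    \<Longrightarrow> eval P E (Arith q e1 e2) (RealV (apply_arith q a b)) (k1 + k2 + 1)"
| eval_IfLe_True: "\<lbrakk>eval P E e1 (RealV a) k1; eval P E e2 (RealV b) k2; a \<le> b; eval P E e3 v k3\<rbrakk>
    \<Longrightarrow> eval P E (IfLe e1 e2 e3 e4) v (k1 + k2 + k3 + 1)"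
| eval_IfLe_False: "\<lbrakk>eval P E e1 (RealV a) k1; eval P E e2 (RealV b) k2; \<not> a \<le> b; eval P E e4 v k3\<rbrakk>
    \<Longrightarrow> eval P E (IfLe e1 e2 e3 e4) v (k1 + k2 + k3 + 1)"
| eval_MkPair: "\<lbrakk>eval P E e1 v1 k1; eval P E e2 v2 k2\<rbrakk>
    \<Longrightarrow> eval P E (MkPair e1 e2) (PairV v1 v2) (k1 + k2 + 1)"
| eval_Fst: "eval P E e (PairV v1 v2) k \<Longrightarrow> eval P E (Fst e) v1 (k + 1)"
| eval_Snd: "eval P E e (PairV v1 v2) k \<Longrightarrow> eval P E (Snd e) v2 (k + 1)"
| eval_IfPair_True: "\<lbrakk>eval P E e1 (PairV w1 w2) k1; eval P E e2 v k2\<rbrakk>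
    \<Longrightarrow> eval P E (IfPair e1 e2 e3) v (k1 + k2 + 1)"
| eval_IfPair_False: "\<lbrakk>eval P E e1 (RealV a) k1; eval P E e3 v k2\<rbrakk>
    \<Longrightarrow> eval P E (IfPair e1 e2 e3) v (k1 + k2 + 1)"
| eval_LetIn: "\<lbrakk>eval P E e1 w k1; eval P (w # E) e2 v k2\<rbrakk>
    \<Longrightarrow> eval P E (LetIn e1 e2) v (k1 + k2 + 1)"
| eval_Call: "\<lbrakk>eval P E e w k1; j < length P; eval P [w] (P ! j) v k2\<rbrakk>
    \<Longrightarrow> eval P E (Call j e) v (k1 + k2 + 1)"

text \<open>A program is run by calling its function number 0.\<close>

definition runs :: "program \<Rightarrow> val \<Rightarrow> val \<Rightarrow> nat \<Rightarrow> bool" where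
  "runs P inp out k \<longleftrightarrow> P \<noteq> [] \<and> eval P [inp] (P ! 0) out k"

primrec enc_list :: "val list \<Rightarrow> val" where
  "enc_list [] = RealV 0"
| "enc_list (v # vs) = PairV v (enc_list vs)"

text \<open>The input is \<open>t\<close> together with the distance matrix of the space, whose points are
  enumerated in the order of \<open>xs\<close>.\<close>

definition enc_input :: "nat \<Rightarrow> ('a \<Rightarrow> 'a \<Rightarrow> real) \<Rightarrow> 'a list \<Rightarrow> val" where
  "enc_input t d xs =
     PairV (RealV (real t)) (enc_list (map (\<lambda>x. enc_list (map (\<lambda>y. RealV (d x y)) xs)) xs))"

text \<open>The output is the labelled tree together with the multi-embedding: a leaf is written as
  the index in \<open>xs\<close> of its image under \<open>f\<close>, and as \<open>-1\<close> if it is outside the domain of \<open>f\<close>.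
  The names of the leaves are immaterial and are not written.\<close>

definition index_of :: "'a list \<Rightarrow> 'a \<Rightarrow> nat" where
  "index_of xs x = length (takeWhile (\<lambda>y. y \<noteq> x) xs)"

primrec enc_output :: "'a list \<Rightarrow> ('b \<rightharpoonup> 'a) \<Rightarrow> 'b ltree \<Rightarrow> val" where
  "enc_output xs f (Leaf p) =
     RealV (case f p of None \<Rightarrow> - 1 | Some x \<Rightarrow> real (index_of xs x))"
| "enc_output xs f (Node D ts) = PairV (RealV D) (enc_list (map (enc_output xs f) ts))"

text \<open>\<open>P\<close> constructs the ultrametric \<open>T\<close> and the multi-embedding \<open>f\<close> in time polynomial in the
  number of points of \<open>T\<close>, with the degree and factor of the polynomial given by \<open>c\<close>. Since \<open>f\<close>
  is surjective, \<open>T\<close> has at least as many points as the input space. A polynomial in the size of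
  the input alone would be too small in general even for writing down \<open>T\<close>.\<close>

definition efficiently_constructs ::
  "program \<Rightarrow> nat \<Rightarrow> nat \<Rightarrow> ('a \<Rightarrow> 'a \<Rightarrow> real) \<Rightarrow> 'a list \<Rightarrow> 'b ltree \<Rightarrow> ('b \<rightharpoonup> 'a) \<Rightarrow> bool" where
  "efficiently_constructs P c t d xs T f \<longleftrightarrow>
     (\<exists>k. runs P (enc_input t d xs) (enc_output xs f T) k \<and> k \<le> c * card (tree_points T) ^ c)"


section \<open>The bounds\<close>

definition size_exponent :: "nat \<Rightarrow> nat \<Rightarrow> real \<Rightarrow> real" where
  "size_exponent n t \<Delta> =
     min (log 2 (real n) powr (1 / real t)) ((real t * log 2 (4 * \<Delta>)) powr (2 / real t))"

text \<open>Every non-contractive multi-embedding of a space with at least two points has path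
  distortion at least 1, whereas \<open>log 2 \<Delta>\<close> tends to 0 as \<open>\<Delta>\<close> tends to 1. The \<open>max 1\<close> accounts for
  this; it is vacuous as soon as \<open>\<Delta> \<ge> 2\<close>.\<close>

definition distortion_order :: "nat \<Rightarrow> nat \<Rightarrow> real \<Rightarrow> real" where
  "distortion_order n t \<Delta> = real t * max 1 (min (log 2 \<Delta>) (log 2 (real n)))"

end

theory Submission
  imports Defs
begin

text \<open>
  Split a subspace \<open>X\<close> with \<open>k\<close> points and diameter \<open>D\<close> into the ball \<open>A\<close> of radius \<open>r + \<delta>\<close>
  around some \<open>u\<close> and the complement of the concentric ball \<open>A'\<close> of radius \<open>r\<close>, where
  \<open>\<delta> = D / (48 t)\<close>, \<open>r + \<delta> \<le> D / 4\<close> and \<open>2 |A| \<le> k\<close>, and recurse. A path that visits \<open>A'\<close> and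
  also leaves \<open>A\<close> travels at least \<open>\<delta>\<close> in between, which pays for the two switches, of cost \<open>D\<close>
  each, around its stay in \<open>A\<close>; as both the size and the diameter are halved in \<open>A\<close>, a path is
  charged at most \<open>O(min (log \<Delta>) (log n))\<close> times.

  For the size, compare the \<open>12 t + 1\<close> concentric balls of radii \<open>i \<delta>\<close>, with \<open>a\<^sub>i\<close> points, around an
  end \<open>u\<close> of a diameter. With \<open>W\<^sub>i = log (k / a\<^sub>i) + \<epsilon> log k\<close>, if all the steps have
  \<open>log (a\<^sub>i\<^sub>+\<^sub>1 / a\<^sub>i) \<ge> s W\<^sub>i\<^sub>+\<^sub>1\<close>, then \<open>W\<close> shrinks by a factor \<open>1 + s\<close> each time, while its total
  decrease is by at most a factor \<open>(1 + \<epsilon>) log k / (1 + \<epsilon> log k)\<close>. So the best step has a small \<open>s\<close>,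
  and it yields at most \<open>k\<close> to the power \<open>1 + \<gamma> (1 + \<epsilon>)\<^sup>j\<close> leaves on spaces of diameter below
  \<open>2\<^sup>j\<close>, for some \<open>\<gamma> = O(s)\<close>. The choice \<open>\<epsilon> = 0\<close> gives the bound in terms of \<open>n\<close>, and \<open>\<epsilon>\<close> of order
  \<open>1 / log \<Delta>\<close> gives both bounds at once; the former is used when \<open>\<Delta> > n\<close>, where \<open>log \<Delta>\<close> need not
  even be polynomial in the size of the tree.

  The best step does not depend on the exponent that is aimed at. Logarithms are only needed up
  to a constant factor, so that a piecewise linear substitute makes it computable by
  field operations.
\<close>

section \<open>A computable substitute for the binary logarithm\<close>

text \<open>Linear interpolation of the binary logarithm between consecutive powers of two. Halving
  an argument that is at least 2 lowers the value by exactly 1, so a recursion on field operations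
  and comparisons computes it.\<close>

definition pwlog :: "real \<Rightarrow> real" where
  "pwlog x = (let j = nat \<lfloor>log 2 x\<rfloor> in real j + x / 2 ^ j - 1)"

lemma pwlog_base: "1 \<le> x \<Longrightarrow> x < 2 \<Longrightarrow> pwlog x = x - 1"
proof -
  assume x: "1 \<le> x" "x < 2"
  have "log 2 x < 1" using x by (subst log_less_iff) auto
  moreover have "0 \<le> log 2 x" using x by simp
  ultimately have "\<lfloor>log 2 x\<rfloor> = 0" by linarith
  then show ?thesis by (simp only: pwlog_def Let_def) simp
qed

lemma pwlog_halve: "2 \<le> x \<Longrightarrow> pwlog x = 1 + pwlog (x / 2)"
proof -
  assume x: "2 \<le> x"
  then have l: "log 2 x = log 2 (x / 2) + 1" by (simp add: log_divide)
  have "0 \<le> log 2 (x / 2)" using x by simp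
  then have "nat \<lfloor>log 2 x\<rfloor> = Suc (nat \<lfloor>log 2 (x / 2)\<rfloor>)" unfolding l by (simp add: nat_add_distrib)
  then show ?thesis by (simp only: pwlog_def Let_def) simp
qed

lemma halving_induct [consumes 1, case_names base halve]:
  fixes x :: real
  assumes "1 \<le> x" "\<And>x. 1 \<le> x \<Longrightarrow> x < 2 \<Longrightarrow> P x" "\<And>x. 2 \<le> x \<Longrightarrow> P (x / 2) \<Longrightarrow> P x"
  shows "P x"
proof -
  obtain j where "x < 2 ^ j" using real_arch_pow[of 2 x] by auto
  then show ?thesis using assms(1)
  proof (induction j arbitrary: x)
    case 0 then show ?case by simp
  next
    case (Suc j)
    show ?case
    proof (cases "x < 2")
      case False
      then show ?thesis using Suc.prems Suc.IH[of "x / 2"] by (intro assms(3)[of x]) auto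
    qed (use Suc.prems assms(2)[of x] in blast)
  qed
qed

lemma pwlog_nonneg: "1 \<le> x \<Longrightarrow> 0 \<le> pwlog x"
  by (induction x rule: halving_induct) (auto simp: pwlog_base pwlog_halve)

lemma pwlog_ge_1: "2 \<le> x \<Longrightarrow> 1 \<le> pwlog x"
  using pwlog_nonneg[of "x / 2"] by (simp add: pwlog_halve)

text \<open>By convexity, \<open>2 powr s\<close> lies below its chord over [0, 1].\<close>

lemma two_powr_le:
  fixes s :: real
  assumes "0 \<le> s" "s \<le> 1"
  shows "2 powr s \<le> 1 + s"
proof -
  have "exp ((1 - s) *\<^sub>R 0 + s *\<^sub>R ln 2) \<le> (1 - s) * exp 0 + s * exp (ln (2::real))"
    by (rule convex_onD[OF exp_convex]) (use assms in simp_all)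
  then show ?thesis by (simp add: powr_def)
qed

text \<open>A concave function lies above its chords. Halving \<open>x\<close> lowers both sides by
  1, which reduces the claim to [1, 2).\<close>

lemma pwlog_le_log: "1 \<le> x \<Longrightarrow> pwlog x \<le> log 2 x"
proof (induction x rule: halving_induct)
  case (base x)
  then have "2 powr (x - 1) \<le> x" using two_powr_le[of "x - 1"] by simp
  then have "x - 1 \<le> log 2 x" using base by (subst le_log_iff) simp_all
  then show ?case by (simp only: pwlog_base[OF base])
next
  case (halve x)
  have "log 2 (x / 2) = log 2 x - 1" using halve(1) by (simp add: log_divide)
  then show ?case using halve by (simp add: pwlog_halve[OF halve(1)])
qed

text \<open>The factor 2 comes from the interval [1, 2), where \<open>log 2 x\<close> is at most
  \<open>(x - 1) / ln 2\<close> and \<open>2 * ln 2\<close> exceeds 1. Each doubling of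
  \<open>x\<close> then adds 1 on the left and 2 on the right.\<close>

lemma log_le_pwlog: "1 \<le> x \<Longrightarrow> log 2 x \<le> 2 * pwlog x"
proof (induction x rule: halving_induct)
  case (base x)
  have "ln x \<le> x - 1" using base by (intro ln_le_minus_one) auto
  also have "\<dots> \<le> (x - 1) * (2 * ln 2)"
    using base ln2_ge_two_thirds mult_left_mono[of 1 "2 * ln 2" "x - 1"] by simp
  finally have "ln x / ln 2 \<le> 2 * (x - 1)" by (simp add: field_simps)
  then show ?case by (simp only: pwlog_base[OF base] log_def)
next
  case (halve x)
  have "log 2 (x / 2) = log 2 x - 1" using halve(1) by (simp add: log_divide)
  then show ?case using halve by (simp add: pwlog_halve[OF halve(1)])
qed

section \<open>Lifting paths across a split\<close>

lemma path_length_Cons: "path_length d (x # y # zs) = d x y + path_length d (y # zs)"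
  by (simp add: path_length_def sum.lessThan_Suc_shift del: sum.lessThan_Suc)

lemma path_length_simps [simp]: "path_length d [] = 0" "path_length d [x] = 0"
  by (simp_all add: path_length_def)

lemma path_length_Cons': "xs \<noteq> [] \<Longrightarrow> path_length d (x # xs) = d x (hd xs) + path_length d xs"
  by (cases xs) (simp_all add: path_length_Cons)

lemma path_length_append:
  assumes "xs \<noteq> []" "ys \<noteq> []"
  shows "path_length d (xs @ ys) = path_length d xs + d (last xs) (hd ys) + path_length d ys"
  using assms(1)
proof (induction xs rule: list_nonempty_induct)
  case (single x)
  then show ?case using assms(2) by (cases ys) (auto simp: path_length_Cons)
next
  case (cons x xs)
  then show ?case by (cases xs) (auto simp: path_length_Cons)
qed

context Metric_space
begin

lemma path_length_nonneg: "0 \<le> path_length d p"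
  by (auto simp: path_length_def intro: sum_nonneg)

lemma dist_hd_le_path_length: "set p \<subseteq> M \<Longrightarrow> y \<in> set p \<Longrightarrow> d (hd p) y \<le> path_length d p"
proof (induction p)
  case (Cons z p)
  show ?case
  proof (cases "p = []")
    case False
    then obtain w q where p: "p = w # q" by (cases p) auto
    have "d z z = 0" using Cons.prems by auto
    show ?thesis
    proof (cases "y = z")
      case True
      then show ?thesis using \<open>d z z = 0\<close> path_length_nonneg[of "z # p"] by simp
    next
      case False
      then have y: "y \<in> set p" using Cons.prems by simp
      have "d z y \<le> d z w + d w y" using Cons.prems p y by (intro triangle) auto
      also have "d w y \<le> path_length d p" using Cons y p by auto
      finally show ?thesis by (simp add: p path_length_Cons)
    qed
  qed (use Cons.prems in auto)
qed simp

lemma dist_le_path_length: "set p \<subseteq> M \<Longrightarrow> x \<in> set p \<Longrightarrow> y \<in> set p \<Longrightarrow> d x y \<le> path_length d p"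
proof (induction p)
  case (Cons z p)
  have le: "path_length d p \<le> path_length d (z # p)"
    by (cases p) (auto simp: path_length_Cons)
  consider "x = z" | "y = z" | "x \<in> set p" "y \<in> set p" using Cons.prems by auto
  then show ?case
  proof cases
    case 1 then show ?thesis using dist_hd_le_path_length[of "z # p" y] Cons.prems by simp
  next
    case 2 then show ?thesis using dist_hd_le_path_length[of "z # p" x] Cons.prems by (simp add: commute)
  next
    case 3 then show ?thesis using Cons le by auto
  qed
qed simp

end

text \<open>Path distortion for a single path. The map \<open>F\<close> is total and
  \<open>N\<close> carries the admissible points, so that one \<open>F\<close> serves a tree and all
  its subtrees.\<close>

definition liftable :: "('b \<Rightarrow> 'b \<Rightarrow> real) \<Rightarrow> 'b set \<Rightarrow> ('b \<Rightarrow> 'a) \<Rightarrow> real \<Rightarrow> ('a \<Rightarrow> 'a \<Rightarrow> real) \<Rightarrow> 'a list \<Rightarrow> bool" where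
  "liftable \<rho> N F \<alpha> d p \<longleftrightarrow> (\<exists>p'. set p' \<subseteq> N \<and> map F p' = p \<and> path_length \<rho> p' \<le> \<alpha> * path_length d p)"

lemma liftable_mono:
  assumes "liftable \<rho> N F \<alpha> d p" "N \<subseteq> N'" "\<alpha> * path_length d p \<le> \<alpha>' * path_length d p"
  shows "liftable \<rho> N' F \<alpha>' d p"
proof -
  obtain p' where "set p' \<subseteq> N" "map F p' = p" "path_length \<rho> p' \<le> \<alpha> * path_length d p"
    using assms(1) unfolding liftable_def by blast
  then show ?thesis unfolding liftable_def using assms(2,3) by (intro exI[of _ p']) auto
qed

lemma path_length_append_le:
  assumes "\<And>x y. x \<in> set xs \<union> set ys \<Longrightarrow> y \<in> set xs \<union> set ys \<Longrightarrow> \<rho> x y \<le> D"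
  shows "path_length \<rho> (xs @ ys) \<le> path_length \<rho> xs + (if xs = [] \<or> ys = [] then 0 else D) + path_length \<rho> ys"
  using assms[of "last xs" "hd ys"] by (auto simp: path_length_append)

text \<open>A stay in the outer ball is lifted with factor \<open>\<alpha>\<close> only, which
  leaves a budget of \<open>\<sigma>\<close> times its length for entering and leaving it. What
  precedes the stay avoids the inner ball and is lifted into \<open>N2\<close>; what follows is
  shorter than \<open>p\<close> and is handled by induction.\<close>

lemma (in Metric_space) liftable_split:
  fixes \<rho> :: "'b \<Rightarrow> 'b \<Rightarrow> real"
  assumes X: "X \<subseteq> M" and u: "u \<in> X"
    and liftA: "\<And>p. set p \<subseteq> {x\<in>X. d u x \<le> r + \<delta>} \<Longrightarrow> liftable \<rho> N1 F \<alpha> d p"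
    and liftB: "\<And>p. set p \<subseteq> {x\<in>X. \<not> d u x \<le> r} \<Longrightarrow> liftable \<rho> N2 F (\<alpha> + \<sigma>) d p"
    and \<rho>: "\<And>x y. x \<in> N1 \<union> N2 \<Longrightarrow> y \<in> N1 \<union> N2 \<Longrightarrow> \<rho> x y \<le> D"
    and \<delta>: "0 \<le> \<delta>" and D: "0 \<le> D" "2 * D \<le> \<sigma> * \<delta>" and \<alpha>: "0 \<le> \<alpha>" "0 \<le> \<sigma>"
    and p: "set p \<subseteq> X"
  shows "liftable \<rho> (N1 \<union> N2) F (\<alpha> + \<sigma>) d p"
  using p
proof (induction p rule: length_induct)
  case (1 p)
  show ?case
  proof (cases "\<exists>x\<in>set p. d u x \<le> r")
    case False
    then show ?thesis using 1 by (intro liftable_mono[OF liftB[of p]]) auto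
  next
    case True
    let ?in = "\<lambda>x. d u x \<le> r + \<delta>"
    obtain ys x zs where p: "p = ys @ x # zs" and x: "d u x \<le> r" and ys: "\<forall>y\<in>set ys. \<not> d u y \<le> r"
      using split_list_first_prop[OF True] by auto
    \<comment> \<open>\<open>a\<close> is the maximal run inside the outer ball around the first visit to the inner ball; the edges
      that enter and leave it are charged to it as well, so \<open>c\<close> is treated on its own.\<close>
    define b where "b = rev (dropWhile ?in (rev ys))"
    define a1 where "a1 = rev (takeWhile ?in (rev ys))"
    define a2 where "a2 = takeWhile ?in zs"
    define c where "c = dropWhile ?in zs"
    have ys_eq: "ys = b @ a1" unfolding a1_def b_def by (metis rev_append rev_rev_ident takeWhile_dropWhile_id)
    have zs_eq: "zs = a2 @ c" by (simp add: a2_def c_def)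
    define a where "a = a1 @ x # a2"
    have p_eq: "p = b @ a @ c" by (simp add: p ys_eq zs_eq a_def)
    have setX: "set b \<subseteq> X" "set a \<subseteq> X" "set c \<subseteq> X" using 1 by (auto simp: p_eq)
    have lastb: "\<not> ?in (last b)" if "b \<noteq> []"
      using that hd_dropWhile[of ?in "rev ys"] by (simp add: b_def last_rev)
    have hdc: "\<not> ?in (hd c)" if "c \<noteq> []"
      using that hd_dropWhile[of ?in zs] by (simp add: c_def)
    have a: "a \<noteq> []" "x \<in> set a" by (auto simp: a_def)
    have bX: "set b \<subseteq> {x \<in> X. \<not> d u x \<le> r}" using setX(1) ys by (auto simp: ys_eq)
    obtain b' where b': "set b' \<subseteq> N2" "map F b' = b" "path_length \<rho> b' \<le> (\<alpha> + \<sigma>) * path_length d b"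
      using liftB[OF bX] unfolding liftable_def by blast
    have "set a1 \<subseteq> {x. ?in x}" "set a2 \<subseteq> {x. ?in x}"
      by (auto simp: a1_def a2_def dest: set_takeWhileD)
    then have "liftable \<rho> N1 F \<alpha> d a" using setX(2) x \<delta> by (intro liftA) (auto simp: a_def)
    then obtain a' where a': "set a' \<subseteq> N1" "map F a' = a" "path_length \<rho> a' \<le> \<alpha> * path_length d a"
      unfolding liftable_def by blast
    have "length c < length p" using a by (simp add: p_eq)
    then have "liftable \<rho> (N1 \<union> N2) F (\<alpha> + \<sigma>) d c" using 1 setX by blast
    then obtain c' where c': "set c' \<subseteq> N1 \<union> N2" "map F c' = c" "path_length \<rho> c' \<le> (\<alpha> + \<sigma>) * path_length d c"
      unfolding liftable_def by blast
    \<comment> \<open>\<open>e\<close> extends \<open>a\<close> by its entering and leaving edges,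
      so that consecutive pieces among \<open>b\<close>, \<open>e\<close>, \<open>c\<close> share an
      end point and their lengths add up to that of \<open>p\<close>.\<close>
    define e where "e = (if b = [] then [] else [last b]) @ a @ (if c = [] then [] else [hd c])"
    have eX: "set e \<subseteq> X" using setX by (auto simp: e_def)
    have pl: "path_length d p = path_length d b + path_length d e + path_length d c"
      using a(1) by (auto simp: p_eq e_def path_length_append path_length_Cons')
    have pl_a: "path_length d a \<le> path_length d e"
      using a(1) by (auto simp: e_def path_length_append path_length_Cons')
    \<comment> \<open>\<open>e\<close> contains \<open>x\<close>, which is in the inner ball, and a
      point outside the outer ball, so it has length at least \<open>\<delta>\<close>. This one
      crossing pays for both switches.\<close>
    have cross: "2 * D \<le> \<sigma> * path_length d e" if "b \<noteq> [] \<or> c \<noteq> []"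
    proof -
      have "\<exists>y\<in>set e. \<not> ?in y"
      proof (cases "b = []")
        case True
        then show ?thesis using that hdc by (intro bexI[of _ "hd c"]) (auto simp: e_def)
      next
        case False
        then show ?thesis using lastb by (intro bexI[of _ "last b"]) (auto simp: e_def)
      qed
      then obtain y where y: "y \<in> set e" "\<not> ?in y" by blast
      have "d u y \<le> d u x + d x y" using y a eX u X by (intro triangle) (auto simp: e_def)
      then have "\<delta> \<le> d x y" using y x by simp
      also have "\<dots> \<le> path_length d e" using y a eX X by (intro dist_le_path_length) (auto simp: e_def)
      finally show ?thesis using D(2) \<alpha>(2) by (meson mult_left_mono order_trans)
    qed
    have N: "set (b' @ a' @ c') \<subseteq> N1 \<union> N2" using b'(1) a'(1) c'(1) by auto
    have append_le: "path_length \<rho> (xs @ ys) \<le> path_length \<rho> xs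
        + (if xs = [] \<or> ys = [] then 0 else D) + path_length \<rho> ys"
      if "set xs \<subseteq> N1 \<union> N2" "set ys \<subseteq> N1 \<union> N2" for xs ys
      by (intro path_length_append_le \<rho>) (use that in blast)+
    have emp: "b' = [] \<longleftrightarrow> b = []" "a' \<noteq> []" "c' = [] \<longleftrightarrow> c = []" using b'(2) a'(2) c'(2) a(1) by auto
    have "path_length \<rho> (b' @ a' @ c') \<le> path_length \<rho> b' + (if b = [] then 0 else D)
        + path_length \<rho> (a' @ c')"
      unfolding emp(1)[symmetric] using append_le[of b' "a' @ c'"] N emp(2) by simp
    also have "path_length \<rho> (a' @ c') \<le> path_length \<rho> a' + (if c = [] then 0 else D) + path_length \<rho> c'"
      unfolding emp(3)[symmetric] using append_le[of a' c'] N emp(2) by simp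
    finally have "path_length \<rho> (b' @ a' @ c') \<le> path_length \<rho> b' + path_length \<rho> a' + path_length \<rho> c'
        + (if b \<noteq> [] \<or> c \<noteq> [] then 2 * D else 0)" using D(1) by (simp split: if_splits)
    also have "(if b \<noteq> [] \<or> c \<noteq> [] then 2 * D else 0) \<le> \<sigma> * path_length d e"
      using cross mult_nonneg_nonneg[OF \<alpha>(2) path_length_nonneg[of e]] by (smt (verit))
    also have "path_length \<rho> b' + path_length \<rho> a' + path_length \<rho> c' + \<sigma> * path_length d e
      \<le> (\<alpha> + \<sigma>) * path_length d b + \<alpha> * path_length d a + (\<alpha> + \<sigma>) * path_length d c
        + \<sigma> * path_length d e"
      using b'(3) a'(3) c'(3) by linarith
    also have "\<alpha> * path_length d a \<le> \<alpha> * path_length d e" using pl_a \<alpha>(1) by (rule mult_left_mono)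
    finally have "path_length \<rho> (b' @ a' @ c') \<le> (\<alpha> + \<sigma>) * path_length d p"
      by (simp add: pl algebra_simps)
    then show ?thesis unfolding liftable_def using N b'(2) a'(2) c'(2) p_eq
      by (intro exI[of _ "b' @ a' @ c'"]) auto
  qed
qed

section \<open>The construction\<close>

definition eccentricity :: "('a \<Rightarrow> 'a \<Rightarrow> real) \<Rightarrow> 'a \<Rightarrow> 'a list \<Rightarrow> real" where
  "eccentricity d x ys = foldr (\<lambda>y. max (d x y)) ys 0"

text \<open>The two lists are kept apart so that a recursion can consume \<open>xs\<close> while
  \<open>ys\<close> stays fixed.\<close>

definition cross_diam :: "('a \<Rightarrow> 'a \<Rightarrow> real) \<Rightarrow> 'a list \<Rightarrow> 'a list \<Rightarrow> real" where
  "cross_diam d ys xs = foldr (\<lambda>x. max (eccentricity d x ys)) xs 0"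

abbreviation list_diam :: "('a \<Rightarrow> 'a \<Rightarrow> real) \<Rightarrow> 'a list \<Rightarrow> real" where
  "list_diam d xs \<equiv> cross_diam d xs xs"

definition ball_in :: "('a \<Rightarrow> 'a \<Rightarrow> real) \<Rightarrow> 'a \<Rightarrow> real \<Rightarrow> 'a list \<Rightarrow> 'a list" where
  "ball_in d u r = filter (\<lambda>x. d u x \<le> r)"

definition ball_out :: "('a \<Rightarrow> 'a \<Rightarrow> real) \<Rightarrow> 'a \<Rightarrow> real \<Rightarrow> 'a list \<Rightarrow> 'a list" where
  "ball_out d u r = filter (\<lambda>x. \<not> d u x \<le> r)"

text \<open>The value \<open>k + 1\<close> marks an infeasible candidate; it exceeds every feasible score.\<close>

definition score :: "('a \<Rightarrow> 'a \<Rightarrow> real) \<Rightarrow> real \<Rightarrow> real \<Rightarrow> 'a list \<Rightarrow> real \<Rightarrow> 'a \<Rightarrow> 'a \<Rightarrow> real" where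
  "score d m \<epsilon> X D u w =
     (let r = d u w; \<delta> = D / m; k = real (length X); a = real (length (ball_in d u (r + \<delta>) X)) in
      if r + \<delta> \<le> D / 4 \<and> 2 * a \<le> k
      then pwlog (a / real (length (ball_in d u r X))) / (pwlog (k / a) + \<epsilon> * pwlog k)
      else k + 1)"

definition best_for :: "('a \<Rightarrow> 'a \<Rightarrow> real) \<Rightarrow> 'a \<Rightarrow> 'a list \<Rightarrow> real \<times> 'a \<times> 'a \<Rightarrow> real \<times> 'a \<times> 'a" where
  "best_for sc u = foldr (\<lambda>w b. if sc u w \<le> fst b then (sc u w, u, w) else b)"

text \<open>The initial entry carries the mark of infeasibility, so that any final score below it
  belongs to an actual candidate.\<close>

definition best_split :: "('a \<Rightarrow> 'a \<Rightarrow> real) \<Rightarrow> 'a list \<Rightarrow> 'a list \<Rightarrow> real \<times> 'a \<times> 'a" where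
  "best_split sc X us = foldr (\<lambda>u. best_for sc u X) us (real (length X) + 1, hd X, hd X)"

text \<open>Leaves hold points of the source space, and the same point may occur at several of them;
  names for the target points are assigned later by \<open>number_leaves\<close>.\<close>

datatype 'a btree = Tip 'a | Br real "'a btree" "'a btree"

text \<open>The test on lengths only serves termination; on metric spaces it always succeeds.\<close>

function build :: "('a \<Rightarrow> 'a \<Rightarrow> real) \<Rightarrow> real \<Rightarrow> real \<Rightarrow> 'a list \<Rightarrow> 'a btree" where
  "build d m \<epsilon> X =
     (if length X \<le> 1 then Tip (hd X)
      else let D = list_diam d X;
               (u, w) = snd (best_split (score d m \<epsilon> X D) X X);
               A = ball_in d u (d u w + D / m) X;
               B = ball_out d u (d u w) X
           in if length A < length X \<and> length B < length X
              then Br D (build d m \<epsilon> A) (build d m \<epsilon> B) else Tip (hd X))"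
  by pat_completeness auto
termination by (relation "Wellfounded.measure (\<lambda>(d, m, \<epsilon>, X). length X)") auto

declare build.simps [simp del]

section \<open>The program\<close>

text \<open>Only upper bounds on the number of steps are tracked, so that bounds compose without
  exact counts.\<close>

definition evb :: "program \<Rightarrow> val list \<Rightarrow> expr \<Rightarrow> val \<Rightarrow> nat \<Rightarrow> bool" where
  "evb P E e v b \<longleftrightarrow> (\<exists>k\<le>b. eval P E e v k)"

definition fcall :: "program \<Rightarrow> nat \<Rightarrow> val \<Rightarrow> val \<Rightarrow> nat \<Rightarrow> bool" where
  "fcall P j w v b \<longleftrightarrow> j < length P \<and> evb P [w] (P ! j) v b"

lemma evbI: "evb P E e v' b' \<Longrightarrow> v' = v \<Longrightarrow> b' \<le> b \<Longrightarrow> evb P E e v b"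
  unfolding evb_def using order_trans by blast

lemma fcallI: "evb P [w] (P ! j) v' b' \<Longrightarrow> j < length P \<Longrightarrow> v' = v \<Longrightarrow> b' \<le> b \<Longrightarrow> fcall P j w v b"
  unfolding fcall_def by (auto intro: evbI)

lemma fcall_mono: "fcall P j w v b' \<Longrightarrow> b' \<le> b \<Longrightarrow> fcall P j w v b"
  unfolding fcall_def by (auto intro: evbI)

lemma evb_Var_0: "evb P (v # E) (Var 0) v 1"
  unfolding evb_def using eval_Var[of 0 "v # E" P] by auto

section \<open>Cost rules for the constructs of the language\<close>

lemma evb_Var_Suc: "evb P E (Var i) v b \<Longrightarrow> evb P (w # E) (Var (Suc i)) v b"
  unfolding evb_def by (erule exE, erule conjE, erule eval.cases) (use eval_Var[of "Suc i" "w # E" P] in auto)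

lemma evb_Lit: "evb P E (Lit z) (RealV (of_int z)) 1"
  unfolding evb_def using eval_Lit by blast

lemma evb_Plus: "evb P E e1 (RealV a) b1 \<Longrightarrow> evb P E e2 (RealV b) b2 \<Longrightarrow>
    evb P E (Arith Plus e1 e2) (RealV (a + b)) (b1 + b2 + 1)"
  unfolding evb_def
  by (elim exE conjE, rule exI, rule conjI[rotated], rule eval_Arith[where q = Plus, unfolded apply_arith.simps])
     auto

lemma evb_Times: "evb P E e1 (RealV a) b1 \<Longrightarrow> evb P E e2 (RealV b) b2 \<Longrightarrow>
    evb P E (Arith Times e1 e2) (RealV (a * b)) (b1 + b2 + 1)"
  unfolding evb_def
  by (elim exE conjE, rule exI, rule conjI[rotated], rule eval_Arith[where q = Times, unfolded apply_arith.simps])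
     auto

lemma evb_Minus: "evb P E e1 (RealV a) b1 \<Longrightarrow> evb P E e2 (RealV b) b2 \<Longrightarrow>
    evb P E (Arith Minus e1 e2) (RealV (a - b)) (b1 + b2 + 1)"
  unfolding evb_def
  by (elim exE conjE, rule exI, rule conjI[rotated], rule eval_Arith[where q = Minus, unfolded apply_arith.simps])
     auto

lemma evb_Divide: "evb P E e1 (RealV a) b1 \<Longrightarrow> evb P E e2 (RealV b) b2 \<Longrightarrow> b \<noteq> 0 \<Longrightarrow>
    evb P E (Arith Divide e1 e2) (RealV (a / b)) (b1 + b2 + 1)"
  unfolding evb_def
  by (elim exE conjE, rule exI, rule conjI[rotated], rule eval_Arith[where q = Divide, unfolded apply_arith.simps])
     auto

text \<open>The costs of both branches are added, which makes the bound independent of the outcome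
  of the test. Each branch is analysed under its own guard, so a guarded division can be
  justified.\<close>

lemma evb_IfLe:
  assumes "evb P E e1 (RealV a) b1" "evb P E e2 (RealV b) b2"
    "a \<le> b \<Longrightarrow> evb P E e3 v b3" "\<not> a \<le> b \<Longrightarrow> evb P E e4 v' b4"
  shows "evb P E (IfLe e1 e2 e3 e4) (if a \<le> b then v else v') (b1 + b2 + (b3 + b4) + 1)"
proof -
  obtain k1 k2 where k: "k1 \<le> b1" "k2 \<le> b2" "eval P E e1 (RealV a) k1" "eval P E e2 (RealV b) k2"
    using assms(1,2) unfolding evb_def by blast
  show ?thesis
  proof (cases "a \<le> b")
    case True
    then obtain k3 where "k3 \<le> b3" "eval P E e3 v k3" using assms(3) unfolding evb_def by blast
    then show ?thesis unfolding evb_def using k True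
      by (intro exI[of _ "k1 + k2 + k3 + 1"]) (use eval_IfLe_True[of P E e1 a k1 e2 b k2 e3 v k3 e4] in auto)
  next
    case False
    then obtain k3 where "k3 \<le> b4" "eval P E e4 v' k3" using assms(4) unfolding evb_def by blast
    then show ?thesis unfolding evb_def using k False
      by (intro exI[of _ "k1 + k2 + k3 + 1"]) (use eval_IfLe_False[of P E e1 a k1 e2 b k2 e4 v' k3 e3] in auto)
  qed
qed

text \<open>With the conditional inside \<open>RealV\<close>, the result fits the rules for
  arithmetic and nests in the shape of \<open>score\<close>.\<close>

lemma evb_IfLe_RealV:
  assumes "evb P E e1 (RealV a) b1" "evb P E e2 (RealV b) b2"
    "a \<le> b \<Longrightarrow> evb P E e3 (RealV x) b3" "\<not> a \<le> b \<Longrightarrow> evb P E e4 (RealV y) b4"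
  shows "evb P E (IfLe e1 e2 e3 e4) (RealV (if a \<le> b then x else y)) (b1 + b2 + (b3 + b4) + 1)"
  using evb_IfLe[OF assms] by (simp split: if_splits)

text \<open>For recursions that are stopped by a comparison: the branch that is not taken may be the
  recursive call, for which no bound is at hand.\<close>

lemma evb_IfLe_le:
  "evb P E e1 (RealV a) b1 \<Longrightarrow> evb P E e2 (RealV b) b2 \<Longrightarrow> evb P E e3 v b3 \<Longrightarrow> a \<le> b \<Longrightarrow>
   evb P E (IfLe e1 e2 e3 e4) v (b1 + b2 + b3 + 1)"
  using evb_IfLe[of P E e1 a b1 e2 b b2 e3 v b3 e4 undefined 0] by simp

lemma evb_IfLe_not_le:
  "evb P E e1 (RealV a) b1 \<Longrightarrow> evb P E e2 (RealV b) b2 \<Longrightarrow> evb P E e4 v b4 \<Longrightarrow> \<not> a \<le> b \<Longrightarrow>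
   evb P E (IfLe e1 e2 e3 e4) v (b1 + b2 + b4 + 1)"
  using evb_IfLe[of P E e1 a b1 e2 b b2 e3 undefined 0 e4 v b4] by simp

lemma evb_MkPair: "evb P E e1 v1 b1 \<Longrightarrow> evb P E e2 v2 b2 \<Longrightarrow> evb P E (MkPair e1 e2) (PairV v1 v2) (b1 + b2 + 1)"
  unfolding evb_def by (elim exE conjE, rule exI, rule conjI[rotated], rule eval_MkPair) auto

lemma evb_Fst: "evb P E e (PairV v1 v2) b \<Longrightarrow> evb P E (Fst e) v1 (b + 1)"
  unfolding evb_def by (elim exE conjE, rule exI, rule conjI[rotated], rule eval_Fst) auto

lemma evb_Snd: "evb P E e (PairV v1 v2) b \<Longrightarrow> evb P E (Snd e) v2 (b + 1)"
  unfolding evb_def by (elim exE conjE, rule exI, rule conjI[rotated], rule eval_Snd) auto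

lemma evb_IfPair_True: "evb P E e1 (PairV w1 w2) b1 \<Longrightarrow> evb P E e2 v b2 \<Longrightarrow>
    evb P E (IfPair e1 e2 e3) v (b1 + b2 + 1)"
  unfolding evb_def by (elim exE conjE, rule exI, rule conjI[rotated], rule eval_IfPair_True) auto

lemma evb_IfPair_False: "evb P E e1 (RealV a) b1 \<Longrightarrow> evb P E e3 v b2 \<Longrightarrow>
    evb P E (IfPair e1 e2 e3) v (b1 + b2 + 1)"
  unfolding evb_def by (elim exE conjE, rule exI, rule conjI[rotated], rule eval_IfPair_False) auto

lemma evb_LetIn: "evb P E e1 w b1 \<Longrightarrow> evb P (w # E) e2 v b2 \<Longrightarrow> evb P E (LetIn e1 e2) v (b1 + b2 + 1)"
  unfolding evb_def by (elim exE conjE, rule exI, rule conjI[rotated], rule eval_LetIn) auto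

lemma evb_Call: "evb P E e w b1 \<Longrightarrow> fcall P j w v b2 \<Longrightarrow> evb P E (Call j e) v (b1 + b2 + 1)"
  unfolding evb_def fcall_def by (elim exE conjE, rule exI, rule conjI[rotated], rule eval_Call) auto

lemmas evb_intros = evb_Var_0 evb_Var_Suc evb_Lit evb_Plus evb_Times evb_Minus evb_Divide
  evb_MkPair evb_Fst evb_Snd evb_LetIn evb_Call

text \<open>The indices are spelled out in unary so that the rules above apply by plain unification.\<close>

abbreviation "V0 \<equiv> Var 0"
abbreviation "V1 \<equiv> Var (Suc 0)"
abbreviation "V2 \<equiv> Var (Suc (Suc 0))"
abbreviation "V3 \<equiv> Var (Suc (Suc (Suc 0)))"
abbreviation "V4 \<equiv> Var (Suc (Suc (Suc (Suc 0))))"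

text \<open>\<open>Call j\<close> refers to the \<open>j\<close>-th entry of \<open>prog\<close>. A point is passed around as its index paired with its
  row of the distance matrix.\<close>

definition main_body :: expr where
  "main_body =
    LetIn (Call 13 (MkPair (Lit 0) (Snd V0)))
   (LetIn (Call 5 (MkPair V0 V0))
     (Call 12 (MkPair (MkPair (Arith Times (Lit 48) (Fst V2))
        (IfLe V0 (Call 3 V1) (Arith Divide (Lit 1) (Arith Plus (Call 8 V0) (Lit 1))) (Lit 0))) V1)))"

definition nth_body :: expr where
  "nth_body = IfLe (Fst V0) (Lit 0) (Fst (Snd V0))
     (Call 1 (MkPair (Arith Minus (Fst V0) (Lit 1)) (Snd (Snd V0))))"

definition dist_body :: expr where
  "dist_body = Call 1 (MkPair (Fst (Snd V0)) (Snd (Fst V0)))"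

definition length_body :: expr where
  "length_body = IfPair V0 (Arith Plus (Call 3 (Snd V0)) (Lit 1)) (Lit 0)"

definition eccentricity_body :: expr where
  "eccentricity_body = IfPair (Snd V0)
     (LetIn (Call 4 (MkPair (Fst V0) (Snd (Snd V0))))
     (LetIn (Call 2 (MkPair (Fst V1) (Fst (Snd V1))))
       (IfLe V0 V1 V1 V0)))
     (Lit 0)"

definition cross_diam_body :: expr where
  "cross_diam_body = IfPair (Snd V0)
     (LetIn (Call 5 (MkPair (Fst V0) (Snd (Snd V0))))
     (LetIn (Call 4 (MkPair (Fst (Snd V1)) (Fst V1)))
       (IfLe V0 V1 V1 V0)))
     (Lit 0)"

definition ball_in_body :: expr where
  "ball_in_body = IfPair (Snd V0)
     (LetIn (Call 6 (MkPair (Fst V0) (Snd (Snd V0))))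
       (IfLe (Call 2 (MkPair (Fst (Fst V1)) (Fst (Snd V1)))) (Snd (Fst V1))
         (MkPair (Fst (Snd V1)) V0) V0))
     (Lit 0)"

definition ball_out_body :: expr where
  "ball_out_body = IfPair (Snd V0)
     (LetIn (Call 7 (MkPair (Fst V0) (Snd (Snd V0))))
       (IfLe (Call 2 (MkPair (Fst (Fst V1)) (Fst (Snd V1)))) (Snd (Fst V1))
         V0 (MkPair (Fst (Snd V1)) V0)))
     (Lit 0)"

definition pwlog_body :: expr where
  "pwlog_body = IfLe (Lit 2) V0 (Arith Plus (Lit 1) (Call 8 (Arith Divide V0 (Lit 2))))
     (Arith Minus V0 (Lit 1))"

text \<open>The argument is the context ((m, \<open>\<epsilon>\<close>), (D, X)) paired with (u, w).
  Below the four bindings, \<open>V0\<close> to \<open>V3\<close> hold k, a, \<open>\<delta>\<close>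
  and r, and \<open>V4\<close> holds the argument.\<close>

definition score_body :: expr where
  "score_body =
    LetIn (Call 2 (Snd V0))
   (LetIn (Arith Divide (Fst (Snd (Fst V1))) (Fst (Fst (Fst V1))))
   (LetIn (Call 3 (Call 6 (MkPair (MkPair (Fst (Snd V2)) (Arith Plus V1 V0)) (Snd (Snd (Fst V2))))))
   (LetIn (Call 3 (Snd (Snd (Fst V3))))
     (IfLe (Arith Plus V3 V2) (Arith Divide (Fst (Snd (Fst V4))) (Lit 4))
       (IfLe (Arith Times (Lit 2) V1) V0
         (Arith Divide
           (Call 8 (Arith Divide V1
             (Call 3 (Call 6 (MkPair (MkPair (Fst (Snd V4)) V3) (Snd (Snd (Fst V4))))))))
           (Arith Plus (Call 8 (Arith Divide V0 V1)) (Arith Times (Snd (Fst (Fst V4))) (Call 8 V0))))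
         (Arith Plus V0 (Lit 1)))
       (Arith Plus V0 (Lit 1))))))"

definition best_for_body :: expr where
  "best_for_body = IfPair (Fst (Snd V0))
     (LetIn (Call 10 (MkPair (Fst V0) (MkPair (Snd (Fst (Snd V0))) (Snd (Snd V0)))))
     (LetIn (Call 9 (MkPair (Fst (Fst V1)) (MkPair (Snd (Fst V1)) (Fst (Fst (Snd V1))))))
       (IfLe V0 (Fst V1) (MkPair V0 (MkPair (Snd (Fst V2)) (Fst (Fst (Snd V2))))) V1)))
     (Snd (Snd V0))"

definition best_split_body :: expr where
  "best_split_body = IfPair (Snd V0)
     (Call 10 (MkPair (MkPair (Fst V0) (Fst (Snd V0)))
       (MkPair (Snd (Snd (Fst V0))) (Call 11 (MkPair (Fst V0) (Snd (Snd V0)))))))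
     (MkPair (Arith Plus (Call 3 (Snd (Snd (Fst V0)))) (Lit 1))
       (MkPair (Fst (Snd (Snd (Fst V0)))) (Fst (Snd (Snd (Fst V0))))))"

text \<open>Testing the tail of the list separates one point from several. The program splits
  without the test on lengths in \<open>build\<close>; the assumption \<open>proper\<close> of
  \<open>encoded_space\<close> makes the two agree. Below the bindings, \<open>V0\<close> to
  \<open>V4\<close> hold r, u, the best candidate, D and the argument.\<close>

definition build_body :: expr where
  "build_body = IfPair (Snd (Snd V0))
     (LetIn (Call 5 (MkPair (Snd V0) (Snd V0)))
     (LetIn (Call 11 (MkPair (MkPair (Fst V1) (MkPair V0 (Snd V1))) (Snd V1)))
     (LetIn (Fst (Snd V0))
     (LetIn (Call 2 (Snd V1))
       (MkPair V3
         (MkPair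
           (Call 12 (MkPair (Fst V4)
             (Call 6 (MkPair (MkPair V1 (Arith Plus V0 (Arith Divide V3 (Fst (Fst V4))))) (Snd V4)))))
         (MkPair
           (Call 12 (MkPair (Fst V4) (Call 7 (MkPair (MkPair V1 V0) (Snd V4)))))
           (Lit 0))))))))
     (Fst (Fst (Snd V0)))"

definition number_rows_body :: expr where
  "number_rows_body = IfPair (Snd V0)
     (MkPair (MkPair (Fst V0) (Fst (Snd V0)))
       (Call 13 (MkPair (Arith Plus (Fst V0) (Lit 1)) (Snd (Snd V0)))))
     (Lit 0)"

definition prog :: program where
  "prog = [main_body, nth_body, dist_body, length_body, eccentricity_body, cross_diam_body,
     ball_in_body, ball_out_body, pwlog_body, score_body, best_for_body, best_split_body,
     build_body, number_rows_body]"

section \<open>Correctness and running time of the routines\<close>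

lemma prog_nth:
  "prog ! 0 = main_body" "prog ! 1 = nth_body" "prog ! 2 = dist_body" "prog ! 3 = length_body"
  "prog ! 4 = eccentricity_body" "prog ! 5 = cross_diam_body" "prog ! 6 = ball_in_body"
  "prog ! 7 = ball_out_body" "prog ! 8 = pwlog_body" "prog ! 9 = score_body"
  "prog ! 10 = best_for_body" "prog ! 11 = best_split_body" "prog ! 12 = build_body"
  "prog ! 13 = number_rows_body"
  by (simp_all add: prog_def)

lemma length_prog: "length prog = 14" by (simp add: prog_def)

lemma fcall_nth:
  "i < length vs \<Longrightarrow> fcall prog 1 (PairV (RealV (real i)) (enc_list vs)) (vs ! i) (20 * (i + 1))"
proof (induction i arbitrary: vs)
  case 0
  then obtain v ws where vs: "vs = v # ws" by (cases vs) auto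
  show ?case
    unfolding fcall_def prog_nth nth_body_def vs enc_list.simps
    by (intro conjI, simp add: length_prog, rule evbI, rule evb_IfLe_le)
       ((rule evb_intros)+, simp_all)
next
  case (Suc i)
  then obtain v ws where vs: "vs = v # ws" by (cases vs) auto
  have IH: "fcall prog 1 (PairV (RealV (real (Suc i) - of_int 1)) (enc_list ws)) (ws ! i) (20 * (i + 1))"
    using Suc.IH[of ws] Suc.prems by (simp add: vs)
  show ?case
    unfolding fcall_def prog_nth nth_body_def vs enc_list.simps
    by (intro conjI, simp add: length_prog, rule evbI, rule evb_IfLe_not_le)
       ((rule evb_intros IH)+, simp_all)
qed

lemma fcall_length: "fcall prog 3 (enc_list vs) (RealV (real (length vs))) (10 * (length vs + 1))"
proof (induction vs)
  case Nil
  show ?case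
    apply (rule fcallI) apply (unfold prog_nth length_body_def enc_list.simps)
    by (rule evb_IfPair_False evb_intros)+ (simp_all add: length_prog)
next
  case (Cons v vs)
  show ?case
    apply (rule fcallI) apply (unfold prog_nth length_body_def enc_list.simps)
    apply (rule evb_IfPair_True evb_intros Cons.IH)+ apply (simp_all add: length_prog)
    done
qed


text \<open>\<open>j\<close> bounds the number of halvings.\<close>

lemma fcall_pwlog:
  "1 \<le> x \<Longrightarrow> x < 2 ^ Suc j \<Longrightarrow> fcall prog 8 (RealV x) (RealV (pwlog x)) (20 * (j + 1))"
proof (induction j arbitrary: x)
  case 0
  show ?case
    unfolding fcall_def prog_nth pwlog_body_def
    by (intro conjI, simp add: length_prog, rule evbI, rule evb_IfLe_not_le)
       ((rule evb_intros)+, use 0 in \<open>simp_all add: pwlog_base\<close>)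
next
  case (Suc j)
  show ?case
  proof (cases "2 \<le> x")
    case True
    have IH: "fcall prog 8 (RealV (x / of_int 2)) (RealV (pwlog (x / 2))) (20 * (j + 1))"
      using Suc.IH[of "x / 2"] Suc.prems True by simp
    have two: "real_of_int 2 \<noteq> 0" by simp
    show ?thesis
      unfolding fcall_def prog_nth pwlog_body_def
      by (intro conjI, simp add: length_prog, rule evbI, rule evb_IfLe_le)
         ((rule evb_intros IH two)+, use True in \<open>simp_all add: pwlog_halve\<close>)
  next
    case False
    show ?thesis
      unfolding fcall_def prog_nth pwlog_body_def
      by (intro conjI, simp add: length_prog, rule evbI, rule evb_IfLe_not_le)
         ((rule evb_intros)+, use Suc.prems False in \<open>simp_all add: pwlog_base\<close>)
  qed
qed

text \<open>The crude estimate of at most \<open>k\<close> halvings suffices for a polynomial bound.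
  It applies to the ratios of cardinalities in \<open>score\<close>, and to the diameter as long as
  that is at most the number of points.\<close>

lemma fcall_pwlog_le:
  assumes "1 \<le> x" "x \<le> real k"
  shows "fcall prog 8 (RealV x) (RealV (pwlog x)) (20 * (k + 1))"
proof (rule fcall_pwlog[OF assms(1)])
  have "real k < real (2 ^ Suc k)" unfolding of_nat_less_iff by (metis Suc_lessD less_exp)
  then show "x < 2 ^ Suc k" using assms(2) by simp
qed

lemma fcall_number_rows:
  "fcall prog 13 (PairV (RealV (real i)) (enc_list rs))
     (enc_list (map (\<lambda>(j, r). PairV (RealV (real j)) r) (List.enumerate i rs))) (20 * (length rs + 1))"
proof (induction rs arbitrary: i)
  case Nil
  show ?case
    apply (rule fcallI) apply (unfold prog_nth number_rows_body_def enc_list.simps)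
    by (rule evb_IfPair_False evb_intros)+ (simp_all add: length_prog)
next
  case (Cons r rs)
  have IH: "fcall prog 13 (PairV (RealV (real i + of_int 1)) (enc_list rs))
     (enc_list (map (\<lambda>(j, r). PairV (RealV (real j)) r) (List.enumerate (Suc i) rs))) (20 * (length rs + 1))"
    using Cons.IH[of "Suc i"] by (simp add: add.commute)
  show ?case
    apply (rule fcallI) apply (unfold prog_nth number_rows_body_def enc_list.simps)
    by (rule evb_IfPair_True evb_intros IH)+ (simp_all add: length_prog)
qed

primrec enc_btree :: "('a \<Rightarrow> real) \<Rightarrow> 'a btree \<Rightarrow> val" where
  "enc_btree idx (Tip x) = RealV (idx x)"
| "enc_btree idx (Br D l r) =
     PairV (RealV D) (PairV (enc_btree idx l) (PairV (enc_btree idx r) (RealV 0)))"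

text \<open>Here \<open>c\<close> bounds one distance lookup and \<open>k\<close> the number of
  points.\<close>

definition score_cost :: "nat \<Rightarrow> nat \<Rightarrow> nat" where
  "score_cost c k = 3 * (c + 40) * (k + 1) + 90 * (k + 1) + 200"

text \<open>The work at one vertex apart from its subtrees: the diameter, the scores of all pairs,
  one distance and the two parts of the split.\<close>

definition node_cost :: "nat \<Rightarrow> nat \<Rightarrow> nat" where
  "node_cost c n = (c + 40) * (n + 2) * (n + 1) + (score_cost c n + 150) * (n + 1) * (n + 1) + c
     + 2 * ((c + 40) * (n + 1)) + 200"

lemma length_ball_in_mono: "r \<le> r' \<Longrightarrow> length (ball_in d u r X) \<le> length (ball_in d u r' X)"
  unfolding ball_in_def by (induction X) auto

lemma length_ball_in_le: "length (ball_in d u r X) \<le> length X"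
  by (simp add: ball_in_def)

text \<open>The routines reach distances only through function 2, so their analysis can abstract
  from the matrix: all that matters is a lookup of cost \<open>c\<close> on encoded points.\<close>

locale encoded_points =
  fixes g :: "'a \<Rightarrow> val" and idx :: "'a \<Rightarrow> real" and row :: "'a \<Rightarrow> val"
    and d :: "'a \<Rightarrow> 'a \<Rightarrow> real" and S :: "'a set" and c :: nat
  assumes fcall_dist: "x \<in> S \<Longrightarrow> y \<in> S \<Longrightarrow> fcall prog 2 (PairV (g x) (g y)) (RealV (d x y)) c"
    and g_eq: "g x = PairV (RealV (idx x)) (row x)"
    and d_self: "x \<in> S \<Longrightarrow> d x x = 0"
    and d_nonneg: "x \<in> S \<Longrightarrow> y \<in> S \<Longrightarrow> 0 \<le> d x y"
begin

abbreviation enc_points :: "'a list \<Rightarrow> val" where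
  "enc_points X \<equiv> enc_list (map g X)"

definition enc_cand :: "real \<times> 'a \<times> 'a \<Rightarrow> val" where
  "enc_cand b = PairV (RealV (fst b)) (PairV (g (fst (snd b))) (g (snd (snd b))))"

lemma fcall_eccentricity:
  assumes "x \<in> S" "set ys \<subseteq> S"
  shows "fcall prog 4 (PairV (g x) (enc_points ys)) (RealV (eccentricity d x ys)) ((c + 40) * (length ys + 1))"
  using assms(2)
proof (induction ys)
  case Nil
  show ?case
    apply (rule fcallI) apply (unfold prog_nth eccentricity_body_def list.map enc_list.simps)
    by (rule evb_IfPair_False evb_intros)+ (simp_all add: length_prog eccentricity_def)
next
  case (Cons y ys)
  then have IH: "fcall prog 4 (PairV (g x) (enc_points ys)) (RealV (eccentricity d x ys)) ((c + 40) * (length ys + 1))"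
    and d: "fcall prog 2 (PairV (g x) (g y)) (RealV (d x y)) c"
    using fcall_dist[OF assms(1), of y] by auto
  show ?case
    apply (rule fcallI) apply (unfold prog_nth eccentricity_body_def list.map enc_list.simps)
    by (rule evb_IfPair_True evb_intros evb_IfLe IH d)+
       (simp_all add: length_prog eccentricity_def max_def algebra_simps)
qed

lemma fcall_cross_diam:
  assumes "set ys \<subseteq> S" "set xs \<subseteq> S"
  shows "fcall prog 5 (PairV (enc_points ys) (enc_points xs)) (RealV (cross_diam d ys xs))
    ((c + 40) * (length ys + 2) * (length xs + 1))"
  using assms(2)
proof (induction xs)
  case Nil
  show ?case
    apply (rule fcallI) apply (unfold prog_nth cross_diam_body_def list.map enc_list.simps)
    by (rule evb_IfPair_False evb_intros)+ (simp_all add: length_prog cross_diam_def)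
next
  case (Cons x xs)
  then have IH: "fcall prog 5 (PairV (enc_points ys) (enc_points xs)) (RealV (cross_diam d ys xs))
      ((c + 40) * (length ys + 2) * (length xs + 1))"
    and d: "fcall prog 4 (PairV (g x) (enc_points ys)) (RealV (eccentricity d x ys)) ((c + 40) * (length ys + 1))"
    using fcall_eccentricity[OF _ assms(1), of x] by auto
  show ?case
    apply (rule fcallI) apply (unfold prog_nth cross_diam_body_def list.map enc_list.simps)
    by (rule evb_IfPair_True evb_intros evb_IfLe IH d)+
       (simp_all add: length_prog cross_diam_def max_def algebra_simps)
qed

lemma fcall_ball_in:
  assumes "u \<in> S" "set xs \<subseteq> S"
  shows "fcall prog 6 (PairV (PairV (g u) (RealV r)) (enc_points xs)) (enc_points (ball_in d u r xs))
    ((c + 40) * (length xs + 1))"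
  using assms(2)
proof (induction xs)
  case Nil
  show ?case
    apply (rule fcallI) apply (unfold prog_nth ball_in_body_def list.map enc_list.simps)
    by (rule evb_IfPair_False evb_intros)+ (simp_all add: length_prog ball_in_def)
next
  case (Cons x xs)
  then have IH: "fcall prog 6 (PairV (PairV (g u) (RealV r)) (enc_points xs)) (enc_points (ball_in d u r xs))
      ((c + 40) * (length xs + 1))"
    and d: "fcall prog 2 (PairV (g u) (g x)) (RealV (d u x)) c"
    using fcall_dist[OF assms(1), of x] by auto
  show ?case
    apply (rule fcallI) apply (unfold prog_nth ball_in_body_def list.map enc_list.simps)
    by (rule evb_IfPair_True evb_intros evb_IfLe IH d)+
       (simp_all add: length_prog ball_in_def algebra_simps)
qed

lemma fcall_ball_out:
  assumes "u \<in> S" "set xs \<subseteq> S"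
  shows "fcall prog 7 (PairV (PairV (g u) (RealV r)) (enc_points xs)) (enc_points (ball_out d u r xs))
    ((c + 40) * (length xs + 1))"
  using assms(2)
proof (induction xs)
  case Nil
  show ?case
    apply (rule fcallI) apply (unfold prog_nth ball_out_body_def list.map enc_list.simps)
    by (rule evb_IfPair_False evb_intros)+ (simp_all add: length_prog ball_out_def)
next
  case (Cons x xs)
  then have IH: "fcall prog 7 (PairV (PairV (g u) (RealV r)) (enc_points xs)) (enc_points (ball_out d u r xs))
      ((c + 40) * (length xs + 1))"
    and d: "fcall prog 2 (PairV (g u) (g x)) (RealV (d u x)) c"
    using fcall_dist[OF assms(1), of x] by auto
  show ?case
    apply (rule fcallI) apply (unfold prog_nth ball_out_body_def list.map enc_list.simps)
    by (rule evb_IfPair_True evb_intros evb_IfLe IH d)+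
       (simp_all add: length_prog ball_out_def algebra_simps)
qed


definition enc_ctx :: "real \<Rightarrow> real \<Rightarrow> 'a list \<Rightarrow> real \<Rightarrow> val" where
  "enc_ctx m \<epsilon> X D = PairV (PairV (RealV m) (RealV \<epsilon>)) (PairV (RealV D) (enc_points X))"

lemma length_ball_in_pos: "u \<in> set X \<Longrightarrow> u \<in> S \<Longrightarrow> 0 \<le> r \<Longrightarrow> 0 < length (ball_in d u r X)"
  by (auto simp: ball_in_def d_self filter_empty_conv intro!: bexI[of _ u])

lemma fcall_score:
  assumes u: "u \<in> set X" and w: "w \<in> S" and X: "set X \<subseteq> S" and m: "0 < m" and \<epsilon>: "0 \<le> \<epsilon>" and D: "0 \<le> D"
  shows "fcall prog 9 (PairV (enc_ctx m \<epsilon> X D) (PairV (g u) (g w))) (RealV (score d m \<epsilon> X D u w))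
    (score_cost c (length X))"
proof -
  define r where "r = d u w"
  define \<delta> where "\<delta> = D / m"
  define k where "k = length X"
  define a where "a = length (ball_in d u (r + \<delta>) X)"
  define a' where "a' = length (ball_in d u r X)"
  have uS: "u \<in> S" using u X by auto
  have r: "0 \<le> r" using d_nonneg uS w by (simp add: r_def)
  have \<delta>: "0 \<le> \<delta>" using D m by (simp add: \<delta>_def)
  have a': "0 < a'" using length_ball_in_pos u uS r by (simp add: a'_def)
  have a'a: "a' \<le> a" using length_ball_in_mono[of r "r + \<delta>"] \<delta> by (simp add: a_def a'_def)
  have ak: "a \<le> k" using length_ball_in_le by (simp add: a_def k_def)
  \<comment> \<open>All arguments of \<open>pwlog\<close> lie between 1 and \<open>k\<close>, as its
    specification and its cost bound require.\<close>
  have div1: "real a / real a' \<ge> 1" "real a / real a' \<le> real k"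
    using a' a'a ak mult_mono[of 1 "real a'" "real a" "real k"] by (auto simp: field_simps)
  have div2: "real k / real a \<ge> 1" "real k / real a \<le> real k" using a' a'a ak by (auto simp: field_simps)
  have k1: "real k \<ge> 1" using a' a'a ak by auto
  have fd: "fcall prog 2 (PairV (g u) (g w)) (RealV r) c" using fcall_dist[OF uS w] by (simp add: r_def)
  have fb: "fcall prog 6 (PairV (PairV (g u) (RealV (r + D / m))) (enc_points X))
      (enc_points (ball_in d u (r + \<delta>) X)) ((c + 40) * (length X + 1))"
    unfolding \<delta>_def by (rule fcall_ball_in[OF uS X])
  have fb': "fcall prog 6 (PairV (PairV (g u) (RealV r)) (enc_points X))
      (enc_points (ball_in d u r X)) ((c + 40) * (length X + 1))"
    by (rule fcall_ball_in[OF uS X])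
  have fl: "fcall prog 3 (enc_points (ball_in d u (r + \<delta>) X)) (RealV (real a)) (10 * (length X + 1))"
    by (rule fcall_mono) (use fcall_length[of "map g (ball_in d u (r + \<delta>) X)"] ak in \<open>auto simp: a_def k_def\<close>)
  have fl': "fcall prog 3 (enc_points (ball_in d u r X)) (RealV (real a')) (10 * (length X + 1))"
    by (rule fcall_mono) (use fcall_length[of "map g (ball_in d u r X)"] ak a'a in \<open>auto simp: a'_def k_def\<close>)
  have flX: "fcall prog 3 (enc_points X) (RealV (real k)) (10 * (length X + 1))"
    using fcall_length[of "map g X"] by (simp add: k_def)
  have p1: "fcall prog 8 (RealV (real a / real a')) (RealV (pwlog (real a / real a'))) (20 * (length X + 1))"
    using fcall_pwlog_le[OF div1] by (simp add: k_def)
  have p2: "fcall prog 8 (RealV (real k / real a)) (RealV (pwlog (real k / real a))) (20 * (length X + 1))"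
    using fcall_pwlog_le[OF div2] by (simp add: k_def)
  have p3: "fcall prog 8 (RealV (real k)) (RealV (pwlog (real k))) (20 * (length X + 1))"
    using fcall_pwlog_le[OF k1, of k] by (simp add: k_def)
  have nz: "m \<noteq> 0" "real_of_int 4 \<noteq> 0" "real a' \<noteq> 0" "real a \<noteq> 0" using m a' a'a by auto
  \<comment> \<open>The division is only reached for feasible candidates, where \<open>k / a\<close>
    is at least 2 and the first summand alone is at least 1.\<close>
  have nz2: "pwlog (real k / real a) + \<epsilon> * pwlog (real k) \<noteq> 0" if "of_int 2 * real a \<le> real k"
  proof -
    have "1 \<le> pwlog (real k / real a)" using that nz(4) by (intro pwlog_ge_1) (simp add: field_simps)
    moreover have "0 \<le> pwlog (real k)" using k1 by (rule pwlog_nonneg)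
    ultimately show ?thesis using \<epsilon> mult_nonneg_nonneg by (smt (verit))
  qed
  have eq: "score d m \<epsilon> X D u w = (if r + D / m \<le> D / of_int 4 then
      if of_int 2 * real a \<le> real k then pwlog (real a / real a') / (pwlog (real k / real a) + \<epsilon> * pwlog (real k))
      else real k + of_int 1 else real k + of_int 1)"
    by (simp add: score_def Let_def a_def a'_def k_def r_def \<delta>_def)
  show ?thesis
    unfolding eq enc_ctx_def
    apply (rule fcallI) apply (unfold prog_nth score_body_def)
    by (rule evb_IfLe_RealV evb_intros fd fb fb' fl fl' flX p1 p2 p3 nz nz2 | assumption)+
       (simp_all add: length_prog score_cost_def algebra_simps)
qed

lemma fcall_best_for:
  assumes u: "u \<in> set X" and X: "set X \<subseteq> S" and m: "0 < m" and \<epsilon>: "0 \<le> \<epsilon>" and D: "0 \<le> D" and ws: "set ws \<subseteq> S"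
  shows "fcall prog 10 (PairV (PairV (enc_ctx m \<epsilon> X D) (g u)) (PairV (enc_points ws) (enc_cand b)))
    (enc_cand (best_for (score d m \<epsilon> X D) u ws b)) ((score_cost c (length X) + 80) * (length ws + 1))"
  using ws
proof (induction ws)
  case Nil
  show ?case
    apply (rule fcallI) apply (unfold prog_nth best_for_body_def list.map enc_list.simps)
    by (rule evb_IfPair_False evb_intros)+ (simp_all add: length_prog best_for_def)
next
  case (Cons w ws)
  then have IH: "fcall prog 10 (PairV (PairV (enc_ctx m \<epsilon> X D) (g u)) (PairV (enc_points ws) (enc_cand b)))
    (PairV (RealV (fst (best_for (score d m \<epsilon> X D) u ws b)))
       (PairV (g (fst (snd (best_for (score d m \<epsilon> X D) u ws b)))) (g (snd (snd (best_for (score d m \<epsilon> X D) u ws b))))))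
    ((score_cost c (length X) + 80) * (length ws + 1))"
    and s: "fcall prog 9 (PairV (enc_ctx m \<epsilon> X D) (PairV (g u) (g w))) (RealV (score d m \<epsilon> X D u w)) (score_cost c (length X))"
    using fcall_score[OF u _ X m \<epsilon> D, of w] by (auto simp: enc_cand_def)
  show ?case
    apply (rule fcallI) apply (unfold prog_nth best_for_body_def list.map enc_list.simps)
    by (rule evb_IfPair_True evb_intros evb_IfLe IH s)+
       (simp_all add: length_prog best_for_def enc_cand_def algebra_simps)
qed

lemma fcall_best_split:
  assumes X: "set X \<subseteq> S" "X \<noteq> []" and m: "0 < m" and \<epsilon>: "0 \<le> \<epsilon>" and D: "0 \<le> D" and us: "set us \<subseteq> set X"
  shows "fcall prog 11 (PairV (enc_ctx m \<epsilon> X D) (enc_points us))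
    (enc_cand (best_split (score d m \<epsilon> X D) X us)) ((score_cost c (length X) + 150) * (length X + 1) * (length us + 1))"
  using us
proof (induction us)
  case Nil
  obtain x xs where x: "X = x # xs" using X by (cases X) auto
  have l: "fcall prog 3 (PairV (g x) (enc_points xs)) (RealV (real (length X))) (10 * (length X + 1))"
    using fcall_length[of "map g X"] by (simp add: x)
  have "150 * (length X + 1) \<le> (score_cost c (length X) + 150) * (length X + 1)" by (intro mult_right_mono) auto
  then show ?case
    apply (intro fcallI) apply (unfold prog_nth best_split_body_def list.map enc_list.simps enc_ctx_def)
       apply (unfold x list.map enc_list.simps)
    by (rule evb_IfPair_False evb_intros l)+ (simp_all add: length_prog best_split_def enc_cand_def x)
next
  case (Cons u us)
  then have IH: "fcall prog 11 (PairV (enc_ctx m \<epsilon> X D) (enc_points us))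
    (enc_cand (best_split (score d m \<epsilon> X D) X us)) ((score_cost c (length X) + 150) * (length X + 1) * (length us + 1))"
    and s: "fcall prog 10 (PairV (PairV (enc_ctx m \<epsilon> X D) (g u))
        (PairV (enc_points X) (enc_cand (best_split (score d m \<epsilon> X D) X us))))
      (enc_cand (best_for (score d m \<epsilon> X D) u X (best_split (score d m \<epsilon> X D) X us)))
      ((score_cost c (length X) + 80) * (length X + 1))"
    using fcall_best_for[OF _ X(1) m \<epsilon> D X(1)] by auto
  \<comment> \<open>The context stays folded, so that \<open>IH\<close> and \<open>s\<close> apply;
    only the access to \<open>X\<close> looks inside it.\<close>
  have xX: "evb prog (PairV (enc_ctx m \<epsilon> X D) w # E) (Snd (Snd (Fst V0))) (enc_points X) 4" for w E
    unfolding enc_ctx_def by (rule evbI) ((rule evb_intros)+, simp_all)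
  show ?case
    apply (rule fcallI) apply (unfold prog_nth best_split_body_def list.map enc_list.simps)
    by (rule evb_IfPair_True xX evb_intros IH s)+
       (simp_all add: length_prog best_split_def algebra_simps)
qed

end

primrec btree_leaves :: "'a btree \<Rightarrow> 'a list" where
  "btree_leaves (Tip x) = [x]"
| "btree_leaves (Br D l r) = btree_leaves l @ btree_leaves r"

text \<open>Both parts are nonempty and smaller than \<open>X\<close>, which is what the recursion
  of the program relies on.\<close>

definition proper_split :: "('a \<Rightarrow> 'a \<Rightarrow> real) \<Rightarrow> real \<Rightarrow> 'a list \<Rightarrow> 'a \<Rightarrow> 'a \<Rightarrow> bool" where
  "proper_split d m X u w \<longleftrightarrow> u \<in> set X \<and> w \<in> set X \<and>
     length (ball_in d u (d u w + list_diam d X / m) X) < length X \<and>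
     length (ball_out d u (d u w) X) < length X \<and>
     ball_in d u (d u w + list_diam d X / m) X \<noteq> [] \<and> ball_out d u (d u w) X \<noteq> []"

lemma eccentricity_nonneg: "0 \<le> eccentricity d x ys"
  unfolding eccentricity_def by (induction ys) auto

lemma cross_diam_nonneg: "0 \<le> cross_diam d ys xs"
  unfolding cross_diam_def by (induction xs) (auto simp: eccentricity_nonneg)

text \<open>The assumption \<open>proper\<close> isolates the one fact about metric spaces that the
  analysis of the recursion uses.\<close>

locale encoded_space = encoded_points +
  fixes m \<epsilon> :: real
  assumes m_pos: "0 < m" and \<epsilon>_nonneg: "0 \<le> \<epsilon>"
    and proper: "set X \<subseteq> S \<Longrightarrow> distinct X \<Longrightarrow> 2 \<le> length X \<Longrightarrow>
      snd (best_split (score d m \<epsilon> X (list_diam d X)) X X) = (u, w) \<Longrightarrow> proper_split d m X u w"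
begin

text \<open>A binary tree with L leaves has 2 L - 1 vertices, each of which is charged
  \<open>node_cost\<close>. The bound \<open>n\<close> is kept fixed throughout the recursion, so
  that this charge is the same everywhere.\<close>

lemma fcall_build:
  assumes "set X \<subseteq> S" "distinct X" "X \<noteq> []" "length X \<le> n"
  shows "fcall prog 12 (PairV (PairV (RealV m) (RealV \<epsilon>)) (enc_points X)) (enc_btree idx (build d m \<epsilon> X))
    (2 * length (btree_leaves (build d m \<epsilon> X)) * node_cost c n - node_cost c n)"
  using assms
proof (induction "length X" arbitrary: X rule: less_induct)
  case less
  define N where "N = node_cost c n"
  show ?case
  proof (cases "length X \<le> 1")
    case True
    then obtain x where x: "X = [x]" using less.prems(3) by (cases X) auto
    have "build d m \<epsilon> X = Tip x" by (subst build.simps) (simp add: x)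
    then show ?thesis
      apply (intro fcallI) apply (unfold prog_nth build_body_def x g_eq list.map enc_list.simps)
      by (rule evb_IfPair_False evb_intros)+ (simp_all add: length_prog node_cost_def)
  next
    case False
    define D where "D = list_diam d X"
    define b where "b = best_split (score d m \<epsilon> X D) X X"
    obtain s u w where b: "b = (s, u, w)" by (cases b) auto
    define A where "A = ball_in d u (d u w + D / m) X"
    define B where "B = ball_out d u (d u w) X"
    have ps: "proper_split d m X u w"
      using proper[of X u w] less.prems False b by (simp add: b_def D_def)
    then have uw: "u \<in> set X" "w \<in> set X" "u \<in> S" "w \<in> S"
      and AB: "length A < length X" "length B < length X" "A \<noteq> []" "B \<noteq> []"
      using less.prems(1) unfolding proper_split_def A_def B_def D_def by auto
    have sub: "set A \<subseteq> S" "set B \<subseteq> S" "distinct A" "distinct B"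
      using less.prems(1,2) by (auto simp: A_def B_def ball_in_def ball_out_def)
    have bd: "build d m \<epsilon> X = Br D (build d m \<epsilon> A) (build d m \<epsilon> B)"
      using False AB b by (subst build.simps) (simp add: A_def B_def b_def D_def Let_def)
    define lA where "lA = length (btree_leaves (build d m \<epsilon> A))"
    define lB where "lB = length (btree_leaves (build d m \<epsilon> B))"
    have pos: "btree_leaves T \<noteq> []" for T :: "'a btree" by (induction T) auto
    then have l1: "1 \<le> lA" "1 \<le> lB" by (simp_all add: lA_def lB_def Suc_le_eq)
    have D0: "0 \<le> D" by (simp add: D_def cross_diam_nonneg)
    have k: "length X \<le> n" by (rule less.prems)
    have fA: "fcall prog 12 (PairV (PairV (RealV m) (RealV \<epsilon>)) (enc_points A)) (enc_btree idx (build d m \<epsilon> A))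
        (2 * lA * N - N)"
      unfolding N_def lA_def using less.hyps[OF AB(1)] sub AB k by simp
    have fB: "fcall prog 12 (PairV (PairV (RealV m) (RealV \<epsilon>)) (enc_points B)) (enc_btree idx (build d m \<epsilon> B))
        (2 * lB * N - N)"
      unfolding N_def lB_def using less.hyps[OF AB(2)] sub AB k by simp
    have fD: "fcall prog 5 (PairV (enc_points X) (enc_points X)) (RealV D) ((c + 40) * (n + 2) * (n + 1))"
      unfolding D_def by (rule fcall_mono[OF fcall_cross_diam[OF less.prems(1) less.prems(1)]])
        (use k in \<open>intro mult_mono, auto\<close>)
    have "score_cost c (length X) \<le> score_cost c n" using k by (auto simp: score_cost_def intro!: add_mono mult_mono)
    then have "(score_cost c (length X) + 150) * (length X + 1) * (length X + 1) \<le> (score_cost c n + 150) * (n + 1) * (n + 1)"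
      using k by (intro mult_mono) simp_all
    from fcall_mono[OF fcall_best_split[OF less.prems(1,3) m_pos \<epsilon>_nonneg D0 order_refl] this]
    have fb: "fcall prog 11 (PairV (PairV (PairV (RealV m) (RealV \<epsilon>)) (PairV (RealV D) (enc_points X))) (enc_points X))
      (PairV (RealV s) (PairV (g u) (g w))) ((score_cost c n + 150) * (n + 1) * (n + 1))"
      unfolding b_def[symmetric] by (simp only: b enc_ctx_def enc_cand_def fst_conv snd_conv)
    have fd: "fcall prog 2 (PairV (g u) (g w)) (RealV (d u w)) c" by (rule fcall_dist) (use uw in auto)
    have f6: "fcall prog 6 (PairV (PairV (g u) (RealV (d u w + D / m))) (enc_points X)) (enc_points A) ((c + 40) * (n + 1))"
      unfolding A_def by (rule fcall_mono[OF fcall_ball_in[OF uw(3) less.prems(1)]]) (use k in \<open>intro mult_mono, auto\<close>)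
    have f7: "fcall prog 7 (PairV (PairV (g u) (RealV (d u w))) (enc_points X)) (enc_points B) ((c + 40) * (n + 1))"
      unfolding B_def by (rule fcall_mono[OF fcall_ball_out[OF uw(3) less.prems(1)]]) (use k in \<open>intro mult_mono, auto\<close>)
    obtain x y xs where X: "X = x # y # xs" using False by (cases X rule: remdups_adj.cases) auto
    have pair: "evb prog [PairV p (enc_points X)] (Snd (Snd V0)) (PairV (g y) (enc_points xs)) 3" for p
      unfolding X list.map enc_list.simps by (rule evbI) ((rule evb_intros)+, simp_all)
    have mn: "m \<noteq> 0" using m_pos by simp
    \<comment> \<open>Subtraction on naturals truncates; the identity holds because both leaf counts
      are positive.\<close>
    have cost: "2 * (lA + lB) * N - N = (2 * lA * N - N) + (2 * lB * N - N) + N"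
    proof -
      obtain i j where "lA = Suc i" "lB = Suc j" using l1 by (metis Suc_le_D One_nat_def)
      then show ?thesis by (simp add: algebra_simps)
    qed
    show ?thesis
      apply (rule fcallI) apply (unfold prog_nth build_body_def)
      apply (rule evb_IfPair_True pair)+
      apply (rule evb_intros fD fb fd f6 f7 fA fB mn)+
      apply (simp_all add: length_prog bd)
      using cost unfolding N_def lA_def lB_def node_cost_def apply simp
      done
  qed
qed

text \<open>The bound contains one \<open>node_cost\<close> more than the recursion consumes; it
  pays for numbering the rows and for computing the diameter and \<open>\<epsilon>\<close>.\<close>

lemma fcall_main:
  assumes xs: "set xs \<subseteq> S" "distinct xs" "xs \<noteq> []"
    and rows: "fcall prog 13 (PairV (RealV 0) M) (enc_points xs) (20 * (length xs + 1))"
    and diam: "1 \<le> list_diam d xs"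
    and \<epsilon>: "\<epsilon> = (if list_diam d xs \<le> real (length xs) then 1 / (pwlog (list_diam d xs) + 1) else 0)"
    and m: "m = 48 * t"
  shows "fcall prog 0 (PairV (RealV t) M) (enc_btree idx (build d m \<epsilon> xs))
    (2 * length (btree_leaves (build d m \<epsilon> xs)) * node_cost c (length xs))"
proof -
  let ?n = "length xs"
  define \<Delta> where "\<Delta> = list_diam d xs"
  define L where "L = length (btree_leaves (build d m \<epsilon> xs))"
  have rows': "fcall prog 13 (PairV (RealV (of_int 0)) M) (enc_points xs) (20 * (?n + 1))" using rows by simp
  have fD: "fcall prog 5 (PairV (enc_points xs) (enc_points xs)) (RealV \<Delta>) ((c + 40) * (?n + 2) * (?n + 1))"
    unfolding \<Delta>_def by (rule fcall_cross_diam[OF xs(1) xs(1)])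
  have fl: "fcall prog 3 (enc_points xs) (RealV (real ?n)) (10 * (?n + 1))"
    using fcall_length[of "map g xs"] by simp
  have fp: "fcall prog 8 (RealV \<Delta>) (RealV (pwlog \<Delta>)) (20 * (?n + 1))" if "\<Delta> \<le> real ?n"
    using that diam by (intro fcall_pwlog_le) (simp_all add: \<Delta>_def)
  have nz: "pwlog \<Delta> + of_int 1 \<noteq> 0" using pwlog_nonneg[of \<Delta>] diam by (simp add: \<Delta>_def)
  have eps: "evb prog (RealV \<Delta> # enc_points xs # E)
      (IfLe V0 (Call 3 V1) (Arith Divide (Lit 1) (Arith Plus (Call 8 V0) (Lit 1))) (Lit 0)) (RealV \<epsilon>)
      (30 * (?n + 1) + 20)" for E
    unfolding \<epsilon> \<Delta>_def[symmetric]
    by (rule evbI, (rule evb_IfLe_RealV evb_intros fl fp nz | assumption)+, simp_all)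
  have fb: "fcall prog 12 (PairV (PairV (RealV (of_int 48 * t)) (RealV \<epsilon>)) (enc_points xs))
      (enc_btree idx (build d m \<epsilon> xs)) (2 * L * node_cost c ?n - node_cost c ?n)"
    using fcall_build[OF xs order_refl] by (simp add: m L_def)
  have "btree_leaves T \<noteq> []" for T :: "'a btree" by (induction T) auto
  then obtain l where l: "L = Suc l" by (metis L_def length_0_conv not0_implies_Suc)
  show ?thesis
    unfolding L_def[symmetric]
    apply (rule fcallI) apply (unfold prog_nth main_body_def)
    apply (rule eps evb_intros rows' fD fb)+
    apply (simp_all add: length_prog l)
    apply (simp add: node_cost_def score_cost_def algebra_simps)
    done
qed

end

section \<open>Choice of the split\<close>

lemma best_for_props:
  "fst (best_for sc u ws b) \<le> fst b"
  "w \<in> set ws \<Longrightarrow> fst (best_for sc u ws b) \<le> sc u w"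
  "best_for sc u ws b = b \<or> (\<exists>w\<in>set ws. best_for sc u ws b = (sc u w, u, w))"
  unfolding best_for_def by (induction ws) auto

lemma best_split_props:
  "fst (best_split sc X us) \<le> real (length X) + 1"
  "u \<in> set us \<Longrightarrow> w \<in> set X \<Longrightarrow> fst (best_split sc X us) \<le> sc u w"
  "best_split sc X us = (real (length X) + 1, hd X, hd X) \<or>
    (\<exists>u\<in>set us. \<exists>w\<in>set X. best_split sc X us = (sc u w, u, w))"
proof (induction us)
  case Nil
  { case 1 then show ?case by (simp add: best_split_def) }
  { case 2 then show ?case by simp }
  { case 3 then show ?case by (simp add: best_split_def) }
next
  case (Cons v us)
  have eq: "best_split sc X (v # us) = best_for sc v X (best_split sc X us)" by (simp add: best_split_def)
  { case 1 then show ?case using Cons(1) best_for_props(1)[of sc v X "best_split sc X us"] by (simp add: eq) }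
  { case 2 then show ?case using Cons(2) best_for_props(1)[of sc v X "best_split sc X us"]
        best_for_props(2)[of w X sc v "best_split sc X us"] by (auto simp: eq) }
  { case 3 then show ?case using Cons(3) best_for_props(3)[of sc v X "best_split sc X us"] by (auto simp: eq) }
qed

section \<open>Extremal distances over lists\<close>

lemma eccentricity_ge: "y \<in> set ys \<Longrightarrow> d x y \<le> eccentricity d x ys"
  unfolding eccentricity_def by (induction ys) auto

lemma eccentricity_le: "0 \<le> R \<Longrightarrow> (\<And>y. y \<in> set ys \<Longrightarrow> d x y \<le> R) \<Longrightarrow> eccentricity d x ys \<le> R"
  unfolding eccentricity_def by (induction ys) auto

lemma cross_diam_ge_eccentricity: "x \<in> set xs \<Longrightarrow> eccentricity d x ys \<le> cross_diam d ys xs"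
  unfolding cross_diam_def by (induction xs) auto

lemma cross_diam_ge: "x \<in> set xs \<Longrightarrow> y \<in> set ys \<Longrightarrow> d x y \<le> cross_diam d ys xs"
  using cross_diam_ge_eccentricity eccentricity_ge by (metis order_trans)

lemma cross_diam_le:
  assumes "0 \<le> R" "\<And>x y. x \<in> set xs \<Longrightarrow> y \<in> set ys \<Longrightarrow> d x y \<le> R"
  shows "cross_diam d ys xs \<le> R"
proof -
  have "\<And>x. x \<in> set xs \<Longrightarrow> eccentricity d x ys \<le> R" using assms eccentricity_le by metis
  then show ?thesis using assms(1) unfolding cross_diam_def by (induction xs) auto
qed

lemma eccentricity_attained: "ys \<noteq> [] \<Longrightarrow> (\<And>y. y \<in> set ys \<Longrightarrow> 0 \<le> d x y) \<Longrightarrow> \<exists>y\<in>set ys. eccentricity d x ys = d x y"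
  unfolding eccentricity_def by (induction ys rule: list_nonempty_induct) (auto simp: max_def)

lemma cross_diam_attained:
  assumes "xs \<noteq> []" "ys \<noteq> []" "\<And>x y. x \<in> set xs \<Longrightarrow> y \<in> set ys \<Longrightarrow> 0 \<le> d x y"
  shows "\<exists>x\<in>set xs. \<exists>y\<in>set ys. cross_diam d ys xs = d x y"
proof -
  have "\<exists>x\<in>set xs. cross_diam d ys xs = eccentricity d x ys"
    using assms(1) unfolding cross_diam_def
    by (induction xs rule: list_nonempty_induct) (auto simp: max_def eccentricity_nonneg intro: antisym)
  then show ?thesis using eccentricity_attained[OF assms(2)] assms(3) by metis
qed

lemma length_filter_disjoint:
  assumes "\<And>x. x \<in> set xs \<Longrightarrow> \<not> (P x \<and> Q x)"
  shows "length (filter P xs) + length (filter Q xs) \<le> length xs"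
  using assms by (induction xs) auto

text \<open>Each step divides the potential \<open>W\<close> by at least \<open>1 + s\<close>. At
  the start \<open>a 0\<close> is at least 1, which bounds \<open>W 0\<close> by
  \<open>(1 + \<epsilon>) * log 2 k\<close>; at the end the ball holds at most half of the points,
  which keeps \<open>W N\<close> above \<open>1 + \<epsilon> * log 2 k\<close>.\<close>

lemma layer_growth:
  fixes a :: "nat \<Rightarrow> nat"
  assumes a0: "1 \<le> a 0" and mono: "\<And>i. i < N \<Longrightarrow> a i \<le> a (Suc i)" and aN: "2 * a N \<le> k"
    and s: "0 \<le> s" and \<epsilon>: "0 \<le> \<epsilon>"
    and step: "\<And>i. i < N \<Longrightarrow> s * (log 2 (k / a (Suc i)) + \<epsilon> * log 2 k) \<le> log 2 (a (Suc i) / a i)"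
  shows "(1 + s) ^ N * (1 + \<epsilon> * log 2 k) \<le> (1 + \<epsilon>) * log 2 k"
proof -
  define W where "W i = log 2 (k / a i) + \<epsilon> * log 2 k" for i
  have pos: "1 \<le> a i" if "i \<le> N" for i using that
  proof (induction i)
    case (Suc i) then show ?case using mono[of i] by auto
  qed (use a0 in simp)
  have kpos: "0 < k" using aN pos[of N] by simp
  have lg: "log 2 (k / a i) = log 2 k - log 2 (a i)" if "i \<le> N" for i
    using pos[OF that] kpos by (simp add: log_divide)
  have "(1 + s) ^ i * W i \<le> W 0" if "i \<le> N" for i
    using that
  proof (induction i)
    case (Suc i)
    have "log 2 (a (Suc i) / a i) = W i - W (Suc i)"
      using pos[of i] pos[of "Suc i"] Suc.prems kpos by (simp add: W_def lg log_divide)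
    then have "(1 + s) * W (Suc i) \<le> W i"
      using step[of i] Suc.prems by (simp add: W_def algebra_simps)
    then have "(1 + s) ^ i * ((1 + s) * W (Suc i)) \<le> (1 + s) ^ i * W i"
      using s by (intro mult_left_mono) auto
    then show ?case using Suc by (simp add: mult_ac)
  qed simp
  from this[of N] have "(1 + s) ^ N * W N \<le> W 0" by simp
  moreover have "W 0 \<le> (1 + \<epsilon>) * log 2 k"
    using a0 by (simp add: W_def lg algebra_simps)
  moreover have "1 + \<epsilon> * log 2 k \<le> W N"
  proof -
    have "real (2 * a N) \<le> real k" using aN by (simp only: of_nat_le_iff)
    then have "2 \<le> real k / real (a N)" using pos[of N] by (simp add: pos_le_divide_eq)
    then have "1 \<le> log 2 (real k / real (a N))" by (subst le_log_iff) auto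
    then show ?thesis by (simp add: W_def)
  qed
  moreover have "0 \<le> (1 + s) ^ N" using s by simp
  ultimately show ?thesis using mult_left_mono[of "1 + \<epsilon> * log 2 k" "W N" "(1 + s) ^ N"] by linarith
qed

context Metric_space
begin

lemma self_in_ball_in: "set X \<subseteq> M \<Longrightarrow> u \<in> set X \<Longrightarrow> 0 \<le> r \<Longrightarrow> u \<in> set (ball_in d u r X)"
  by (auto simp: ball_in_def)

lemma length_ball_in_pos: "set X \<subseteq> M \<Longrightarrow> u \<in> set X \<Longrightarrow> 0 \<le> r \<Longrightarrow> 1 \<le> length (ball_in d u r X)"
  using self_in_ball_in by (metis One_nat_def Suc_leI length_pos_if_in_set)

lemma list_diam_pos:
  assumes "set X \<subseteq> M" "distinct X" "2 \<le> length X"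
  shows "0 < list_diam d X"
proof -
  obtain x y ys where X: "X = x # y # ys" using assms(3) by (cases X rule: remdups_adj.cases) auto
  then have "0 < d x y" using assms by auto
  also have "d x y \<le> list_diam d X" by (rule cross_diam_ge) (auto simp: X)
  finally show ?thesis .
qed

text \<open>By the triangle inequality, the balls of radius D / 4 around the two ends of a diameter
  are disjoint, so one of them has at most half of the points.\<close>

lemma sparse_ball_exists:
  assumes X: "set X \<subseteq> M" "distinct X" "2 \<le> length X"
  shows "\<exists>u\<in>set X. 2 * length (ball_in d u (list_diam d X / 4) X) \<le> length X"
proof -
  let ?D = "list_diam d X"
  have "X \<noteq> []" using X(3) by auto
  then obtain p q where pq: "p \<in> set X" "q \<in> set X" "?D = d p q"
    using cross_diam_attained[of X X d] by auto
  have "length (ball_in d p (?D / 4) X) + length (ball_in d q (?D / 4) X) \<le> length X"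
    unfolding ball_in_def
  proof (rule length_filter_disjoint)
    fix x assume x: "x \<in> set X"
    have "d p q \<le> d p x + d x q" using x pq X by (intro triangle) auto
    then show "\<not> (d p x \<le> ?D / 4 \<and> d q x \<le> ?D / 4)"
      using list_diam_pos[OF X] pq(3) by (simp add: commute[of x q])
  qed
  then have "2 * length (ball_in d p (?D / 4) X) \<le> length X \<or> 2 * length (ball_in d q (?D / 4) X) \<le> length X" by linarith
  then show ?thesis using pq by auto
qed

text \<open>The last two bounds translate the score back to logarithms; since \<open>pwlog\<close>
  is exact up to a factor 2, each direction loses that factor once. The bound by
  \<open>k + 1\<close> holds because the denominator of a feasible score is at least 1 and its
  numerator at most \<open>log 2 k\<close>; it separates such scores from the mark of
  infeasibility.\<close>

lemma feasible_score:
  fixes m D \<epsilon> :: real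
  assumes X: "set X \<subseteq> M" and u: "u \<in> set X" and m: "0 < m" and D: "0 < D" and \<epsilon>: "0 \<le> \<epsilon>" and w: "w \<in> M"
    and feas: "d u w + D / m \<le> D / 4" "2 * length (ball_in d u (d u w + D / m) X) \<le> length X"
  defines "k \<equiv> real (length X)" and "a \<equiv> real (length (ball_in d u (d u w + D / m) X))"
    and "a' \<equiv> real (length (ball_in d u (d u w) X))"
  shows "0 \<le> score d m \<epsilon> X D u w" "score d m \<epsilon> X D u w < k + 1"
    "score d m \<epsilon> X D u w / 2 * (log 2 (k / a) + \<epsilon> * log 2 k) \<le> log 2 (a / a')"
    "log 2 (a / a') \<le> 2 * score d m \<epsilon> X D u w * (log 2 (k / a) + \<epsilon> * log 2 k)"
proof -
  let ?s = "score d m \<epsilon> X D u w"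
  define R where "R = pwlog (k / a) + \<epsilon> * pwlog k"
  have a'1: "1 \<le> a'" using length_ball_in_pos[OF X u, of "d u w"] by (simp add: a'_def)
  have a'a: "a' \<le> a" unfolding a_def a'_def of_nat_le_iff ball_in_def
    using m D by (induction X) (auto simp: add_increasing2)
  have ak: "2 * a \<le> k" using feas(2) unfolding a_def k_def by linarith
  have aa: "1 \<le> a / a'" using a'1 a'a by simp
  have ka: "2 \<le> k / a" using a'1 a'a ak by (simp add: field_simps)
  have k1: "1 \<le> k" using a'1 a'a ak by simp
  have s: "?s = pwlog (a / a') / R" using feas by (simp add: score_def Let_def a_def a'_def k_def R_def)
  have R1: "1 \<le> R" using pwlog_ge_1[OF ka] mult_nonneg_nonneg[OF \<epsilon> pwlog_nonneg[OF k1]] by (simp add: R_def)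
  have p0: "0 \<le> pwlog (a / a')" by (rule pwlog_nonneg[OF aa])
  show s0: "0 \<le> ?s" using p0 R1 by (simp add: s)
  have "?s \<le> pwlog (a / a')" unfolding s using p0 R1 by (simp add: divide_le_eq mult_left_mono[of 1 R, simplified] mult_le_cancel_left1)
  also have "\<dots> \<le> log 2 (a / a')" by (rule pwlog_le_log[OF aa])
  also have "\<dots> \<le> log 2 k"
  proof -
    have "a / a' \<le> k" using a'1 a'a ak mult_mono[of 1 a' a k] by (simp add: field_simps)
    then show ?thesis using aa k1 by (subst log_le_cancel_iff) auto
  qed
  also have "\<dots> < k + 1"
  proof -
    have "k < 2 ^ length X" unfolding k_def by (metis of_nat_less_two_power)
    then have "log 2 k < real (length X)" using k1 by (subst log_less_iff) (auto simp: powr_realpow)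
    then show ?thesis by (simp add: k_def)
  qed
  finally show "?s < k + 1" .
  have sR: "?s * R = pwlog (a / a')" using R1 by (simp add: s)
  have "log 2 (k / a) \<le> 2 * pwlog (k / a)" "log 2 k \<le> 2 * pwlog k" using log_le_pwlog ka k1 by auto
  then have "log 2 (k / a) + \<epsilon> * log 2 k \<le> 2 * R"
    using mult_left_mono[OF _ \<epsilon>, of "log 2 k" "2 * pwlog k"] by (simp add: R_def)
  then have "?s / 2 * (log 2 (k / a) + \<epsilon> * log 2 k) \<le> ?s / 2 * (2 * R)" using s0 by (intro mult_left_mono) auto
  also have "\<dots> = pwlog (a / a')" using sR by simp
  also have "\<dots> \<le> log 2 (a / a')" by (rule pwlog_le_log[OF aa])
  finally show "?s / 2 * (log 2 (k / a) + \<epsilon> * log 2 k) \<le> log 2 (a / a')" .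
  have "log 2 (a / a') \<le> 2 * pwlog (a / a')" by (rule log_le_pwlog[OF aa])
  also have "\<dots> = 2 * ?s * R" using sR by simp
  also have "\<dots> \<le> 2 * ?s * (log 2 (k / a) + \<epsilon> * log 2 k)"
  proof (rule mult_left_mono)
    have "pwlog (k / a) \<le> log 2 (k / a)" "pwlog k \<le> log 2 k" using pwlog_le_log ka k1 by auto
    then show "R \<le> log 2 (k / a) + \<epsilon> * log 2 k" using mult_left_mono[OF _ \<epsilon>, of "pwlog k" "log 2 k"] by (simp add: R_def)
  qed (use s0 in simp)
  finally show "log 2 (a / a') \<le> 2 * ?s * (log 2 (k / a) + \<epsilon> * log 2 k)" .
qed

text \<open>With m = 4 N, the N layers of width D / m around a sparse centre fill exactly the radius
  D / 4. Every layer yields a feasible candidate scoring no better than the optimum, so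
  \<open>layer_growth\<close> limits the optimal score, although the optimal pair may have another
  centre.\<close>

lemma best_split_correct:
  fixes N :: nat and \<epsilon> :: real
  assumes X: "set X \<subseteq> M" "distinct X" "2 \<le> length X" and N: "1 \<le> N" and \<epsilon>: "0 \<le> \<epsilon>"
    and best: "snd (best_split (score d (4 * N) \<epsilon> X (list_diam d X)) X X) = (u, w)"
  defines "D \<equiv> list_diam d X" and "k \<equiv> length X"
  defines "a \<equiv> length (ball_in d u (d u w + D / (4 * N)) X)" and "a' \<equiv> length (ball_in d u (d u w) X)"
  shows "u \<in> set X" "w \<in> set X" "d u w + D / (4 * N) \<le> D / 4" "2 * a \<le> k" "1 \<le> a'"
    "\<exists>s\<ge>0. (1 + s) ^ N * (1 + \<epsilon> * log 2 k) \<le> (1 + \<epsilon>) * log 2 k \<and>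
       log 2 (a / a') \<le> 4 * s * (log 2 (k / a) + \<epsilon> * log 2 k)"
proof -
  define sc where "sc = score d (4 * N) \<epsilon> X D"
  define \<delta> where "\<delta> = D / (4 * N)"
  define s where "s = fst (best_split sc X X)"
  have D: "0 < D" unfolding D_def by (rule list_diam_pos[OF X])
  have \<delta>: "0 < \<delta>" using D N by (simp add: \<delta>_def)
  have N\<delta>: "real N * \<delta> = D / 4" using N by (simp add: \<delta>_def)
  have best': "best_split sc X X = (s, u, w)" using best by (simp add: sc_def D_def s_def prod_eq_iff)
  obtain v where v: "v \<in> set X" "2 * length (ball_in d v (D / 4) X) \<le> k"
    using sparse_ball_exists[OF X] by (auto simp: D_def k_def)
  define b where "b i = length (ball_in d v (i * \<delta>) X)" for i :: nat
  have ball_mono: "length (ball_in d v r X) \<le> length (ball_in d v r' X)" if "r \<le> r'" for r r'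
    unfolding ball_in_def using that by (induction X) auto
  \<comment> \<open>Candidate radii are distances between points. Lowering the radius of a layer to
    the largest distance attained within its inner ball leaves that ball unchanged and can only
    shrink the outer one.\<close>
  have cand: "\<exists>y\<in>set X. d v y + \<delta> \<le> D / 4 \<and> 2 * length (ball_in d v (d v y + \<delta>) X) \<le> k \<and>
      length (ball_in d v (d v y + \<delta>) X) \<le> b (Suc i) \<and> length (ball_in d v (d v y) X) = b i"
    if i: "i < N" for i
  proof -
    let ?B = "ball_in d v (i * \<delta>) X"
    have ne: "v \<in> set ?B" using self_in_ball_in[OF X(1) v(1)] \<delta> by simp
    define r where "r = Max (d v ` set ?B)"
    have "r \<in> d v ` set ?B" unfolding r_def by (rule Max_in) (use ne in auto)
    then obtain y where y: "y \<in> set ?B" "r = d v y" by auto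
    have ry: "r \<le> i * \<delta>" using y by (simp add: ball_in_def)
    have "ball_in d v r X = ?B"
      unfolding ball_in_def
    proof (rule filter_cong)
      fix z assume z: "z \<in> set X"
      show "(d v z \<le> r) = (d v z \<le> i * \<delta>)"
      proof
        assume "d v z \<le> i * \<delta>"
        then have "z \<in> set ?B" using z by (simp add: ball_in_def)
        then show "d v z \<le> r" unfolding r_def by (intro Max_ge) auto
      qed (use ry in simp)
    qed simp
    then have "length (ball_in d v (d v y) X) = b i" using y(2) by (simp add: b_def)
    moreover have le: "d v y + \<delta> \<le> real (Suc i) * \<delta>" using ry y(2) by (simp add: algebra_simps)
    moreover have "real (Suc i) * \<delta> \<le> real N * \<delta>" using i \<delta> by (intro mult_right_mono) auto
    then have le4: "d v y + \<delta> \<le> D / 4" using le N\<delta> by linarith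
    moreover have "2 * length (ball_in d v (d v y + \<delta>) X) \<le> k" using ball_mono[OF le4] v(2) by linarith
    moreover have "length (ball_in d v (d v y + \<delta>) X) \<le> b (Suc i)" unfolding b_def by (rule ball_mono[OF le])
    moreover have "y \<in> set X" using y by (simp add: ball_in_def)
    ultimately show ?thesis by blast
  qed
  have m0: "0 < real (4 * N)" using N by simp
  \<comment> \<open>Layer 0 provides a feasible candidate, so the minimum is below the mark and the
    pair found is feasible as well.\<close>
  have "s < real k + 1"
  proof -
    obtain y where y: "y \<in> set X" "d v y + \<delta> \<le> D / 4" "2 * length (ball_in d v (d v y + \<delta>) X) \<le> k"
      using cand[of 0] N by auto
    have "s \<le> sc v y" using best_split_props(2)[OF v(1) y(1), of sc] by (simp add: s_def)
    also have "sc v y < real k + 1" unfolding sc_def k_def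
      by (rule feasible_score(2)[OF X(1) v(1) m0 D \<epsilon>]) (use y X in \<open>auto simp: \<delta>_def k_def\<close>)
    finally show ?thesis .
  qed
  then have "\<exists>u\<in>set X. \<exists>w\<in>set X. best_split sc X X = (sc u w, u, w)"
    using best_split_props(3)[of sc X X] best' by (auto simp: k_def)
  then have uw: "u \<in> set X" "w \<in> set X" and s_eq: "s = sc u w" using best' by auto
  show "u \<in> set X" "w \<in> set X" by fact+
  have feas: "d u w + D / (4 * N) \<le> D / 4 \<and> 2 * a \<le> k"
  proof (rule ccontr)
    assume neg: "\<not> ?thesis"
    have "2 * real (length (ball_in d u (d u w + D / (4 * N)) X)) \<le> real (length X) \<longleftrightarrow> 2 * a \<le> k"
      unfolding a_def k_def by linarith
    with neg have "sc u w = real k + 1" by (auto simp: sc_def score_def Let_def k_def a_def)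
    then show False using \<open>s < real k + 1\<close> s_eq by simp
  qed
  then show feas': "d u w + D / (4 * N) \<le> D / 4" "2 * a \<le> k" by auto
  show "1 \<le> a'" unfolding a'_def using length_ball_in_pos[OF X(1) uw(1)] by simp
  have fs: "d u w + D / real (4 * N) \<le> D / 4" "2 * length (ball_in d u (d u w + D / real (4 * N)) X) \<le> length X" "w \<in> M"
    using feas' uw X by (auto simp: a_def k_def)
  have s0: "0 \<le> s" unfolding s_eq sc_def by (rule feasible_score(1)[OF X(1) uw(1) m0 D \<epsilon> fs(3,1,2)])
  have up: "log 2 (a / a') \<le> 4 * (s / 2) * (log 2 (k / a) + \<epsilon> * log 2 k)"
    using feasible_score(4)[OF X(1) uw(1) m0 D \<epsilon> fs(3,1,2)] by (simp add: s_eq sc_def a_def a'_def k_def)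
  have "(1 + s / 2) ^ N * (1 + \<epsilon> * log 2 k) \<le> (1 + \<epsilon>) * log 2 k"
  proof (rule layer_growth)
    show "1 \<le> b 0" unfolding b_def using length_ball_in_pos[OF X(1) v(1)] by simp
    show "b i \<le> b (Suc i)" for i unfolding b_def using \<delta> by (intro ball_mono) (simp add: algebra_simps)
    show "2 * b N \<le> k" unfolding b_def N\<delta> by (rule v(2))
    fix i assume "i < N"
    then obtain y where y: "y \<in> set X" "d v y + \<delta> \<le> D / 4" "2 * length (ball_in d v (d v y + \<delta>) X) \<le> k"
      "length (ball_in d v (d v y + \<delta>) X) \<le> b (Suc i)" "length (ball_in d v (d v y) X) = b i"
      using cand by blast
    define e where "e = length (ball_in d v (d v y + \<delta>) X)"
    have e1: "1 \<le> e" unfolding e_def using length_ball_in_pos[OF X(1) v(1), of "d v y + \<delta>"] \<delta> by (simp add: add_nonneg_nonneg)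
    have b1: "1 \<le> b i" unfolding y(5)[symmetric] using length_ball_in_pos[OF X(1) v(1)] by simp
    have eb: "e \<le> b (Suc i)" using y(4) by (simp add: e_def)
    have ek: "2 * e \<le> k" using y(3) by (simp add: e_def)
    have sy: "s \<le> sc v y" using best_split_props(2)[OF v(1) y(1), of sc] by (simp add: s_def)
    have yM: "y \<in> M" "d v y + D / real (4 * N) \<le> D / 4" "2 * length (ball_in d v (d v y + D / real (4 * N)) X) \<le> length X"
      using y X by (auto simp: \<delta>_def k_def)
    \<comment> \<open>The outer ball of the candidate has \<open>e\<close> points, at most as many
      as the next layer, so replacing one by the other only increases
      \<open>log 2 (k / e)\<close>.\<close>
    have "s / 2 * (log 2 (k / b (Suc i)) + \<epsilon> * log 2 k) \<le> s / 2 * (log 2 (k / e) + \<epsilon> * log 2 k)"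
      using s0 e1 eb ek by (intro mult_left_mono add_right_mono) (auto simp: log_divide)
    also have "\<dots> \<le> sc v y / 2 * (log 2 (k / e) + \<epsilon> * log 2 k)"
      using sy e1 ek \<epsilon> by (intro mult_right_mono add_nonneg_nonneg mult_nonneg_nonneg) (auto simp: field_simps)
    also have "\<dots> \<le> log 2 (e / b i)"
      using feasible_score(3)[OF X(1) v(1) m0 D \<epsilon> yM] y(5) by (simp add: sc_def k_def e_def \<delta>_def)
    also have "\<dots> \<le> log 2 (b (Suc i) / b i)" using e1 b1 eb by (simp add: log_divide)
    finally show "s / 2 * (log 2 (k / b (Suc i)) + \<epsilon> * log 2 k) \<le> log 2 (b (Suc i) / b i)" .
  qed (use s0 \<epsilon> in auto)
  then show "\<exists>s\<ge>0. (1 + s) ^ N * (1 + \<epsilon> * log 2 k) \<le> (1 + \<epsilon>) * log 2 k \<and>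
       log 2 (a / a') \<le> 4 * s * (log 2 (k / a) + \<epsilon> * log 2 k)"
    \<comment> \<open>The witness is half the optimal score: the lower bounds on the layers lose a
      factor 2 and the upper bound on the chosen pair another one, hence the 4.\<close>
    using up s0 by (intro exI[of _ "s / 2"]) auto
qed

end

section \<open>Size and distortion of the tree\<close>

context Metric_space
begin

section \<open>The two parts of a split\<close>

lemma list_diam_ball:
  assumes X: "set X \<subseteq> M" and u: "u \<in> set X" and r: "0 \<le> r"
  shows "list_diam d (ball_in d u r X) \<le> 2 * r"
proof (rule cross_diam_le)
  fix x y assume xy: "x \<in> set (ball_in d u r X)" "y \<in> set (ball_in d u r X)"
  then have "x \<in> M" "y \<in> M" "u \<in> M" using X u by (auto simp: ball_in_def)
  then have "d x y \<le> d x u + d u y" by (intro triangle)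
  then show "d x y \<le> 2 * r" using xy by (simp add: ball_in_def commute[of x u])
qed (use r in simp)

lemma list_diam_mono: "set Y \<subseteq> set X \<Longrightarrow> list_diam d Y \<le> list_diam d X"
  by (rule cross_diam_le) (auto intro: cross_diam_ge cross_diam_nonneg)

lemma length_ball_in_out: "length (ball_in d u r X) + length (ball_out d u r X) = length X"
  unfolding ball_in_def ball_out_def by (rule sum_length_filter_compl)

text \<open>The outer ball, and with it the inner one, has at most half of the points, so the
  complement of the inner ball is nonempty; it is not all of \<open>X\<close> because the inner ball
  contains \<open>u\<close>.\<close>

lemma proper_split_best:
  fixes N :: nat
  assumes X: "set X \<subseteq> M" "distinct X" "2 \<le> length X" and N: "1 \<le> N" and \<epsilon>: "0 \<le> \<epsilon>"
    and best: "snd (best_split (score d (4 * N) \<epsilon> X (list_diam d X)) X X) = (u, w)"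
  shows "proper_split d (4 * N) X u w"
proof -
  note b = best_split_correct[OF assms]
  let ?D = "list_diam d X"
  have le: "length (ball_in d u (d u w) X) \<le> length (ball_in d u (d u w + ?D / (4 * N)) X)"
    using cross_diam_nonneg[of d X X] by (intro length_ball_in_mono) simp
  have "length (ball_in d u (d u w) X) + length (ball_out d u (d u w) X) = length X" by (rule length_ball_in_out)
  then show ?thesis unfolding proper_split_def using b(1-5) le X(3)
    by (auto simp flip: length_greater_0_conv)
qed

text \<open>Collects once what the later inductions use about a split. The size of the inner ball
  appears as \<open>length X - length B\<close>, and the diameter of \<open>A\<close> is at most
  twice its radius, hence at most D / 2.\<close>

lemma build_induct [consumes 5, case_names single split]:
  fixes N :: nat
  assumes X: "set X \<subseteq> M" "distinct X" "X \<noteq> []" and N: "1 \<le> N" and \<epsilon>: "0 \<le> \<epsilon>"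
    and single: "\<And>x. x \<in> M \<Longrightarrow> P [x] (Tip x)"
    and split: "\<And>X u w A B D.
      \<lbrakk>set X \<subseteq> M; distinct X; 2 \<le> length X; D = list_diam d X; 0 < D; u \<in> set X; w \<in> set X;
       A = ball_in d u (d u w + D / (4 * N)) X; B = ball_out d u (d u w) X; A \<noteq> []; B \<noteq> [];
       d u w + D / (4 * N) \<le> D / 4; 2 * length A \<le> length X;
       \<exists>s\<ge>0. (1 + s) ^ N * (1 + \<epsilon> * log 2 (length X)) \<le> (1 + \<epsilon>) * log 2 (length X) \<and>
         log 2 (length A / (length X - length B))
           \<le> 4 * s * (log 2 (length X / length A) + \<epsilon> * log 2 (length X));
       length B < length X; list_diam d A \<le> D / 2;
       P A (build d (4 * N) \<epsilon> A); P B (build d (4 * N) \<epsilon> B)\<rbrakk>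
      \<Longrightarrow> P X (Br D (build d (4 * N) \<epsilon> A) (build d (4 * N) \<epsilon> B))"
  shows "P X (build d (4 * N) \<epsilon> X)"
  using X
proof (induction "length X" arbitrary: X rule: less_induct)
  case less
  show ?case
  proof (cases "length X \<le> 1")
    case True
    then obtain x where x: "X = [x]" using less.prems(3) by (cases X) auto
    have "build d (4 * N) \<epsilon> X = Tip x" by (subst build.simps) (simp add: x)
    then show ?thesis using single less.prems(1) by (simp add: x)
  next
    case False
    then have X2: "2 \<le> length X" by simp
    note X = less.prems(1,2) X2
    define D where "D = list_diam d X"
    obtain u w where uw: "snd (best_split (score d (4 * N) \<epsilon> X D) X X) = (u, w)" by fastforce
    define A where "A = ball_in d u (d u w + D / (4 * N)) X"
    define B where "B = ball_out d u (d u w) X"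
    have D: "0 < D" unfolding D_def by (rule list_diam_pos[OF X])
    note b = best_split_correct[OF X N \<epsilon> uw[unfolded D_def], folded D_def, folded A_def]
    have ps: "length A < length X" "length B < length X" "A \<noteq> []" "B \<noteq> []"
      using proper_split_best[OF X N \<epsilon> uw[unfolded D_def]] by (simp_all add: proper_split_def A_def B_def D_def)
    have len: "length (ball_in d u (d u w) X) = length X - length B"
      using length_ball_in_out[of u "d u w" X] by (simp add: B_def)
    have bd: "build d (4 * N) \<epsilon> X = Br D (build d (4 * N) \<epsilon> A) (build d (4 * N) \<epsilon> B)"
      using False ps uw by (subst build.simps) (simp add: A_def B_def D_def Let_def)
    have "0 \<le> d u w + D / (4 * N)" using D by simp
    then have "list_diam d A \<le> 2 * (d u w + D / (4 * N))"
      unfolding A_def by (rule list_diam_ball[OF X(1) b(1)])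
    then have dA: "list_diam d A \<le> D / 2" using mult_left_mono[OF b(3), of 2] by simp
    have sub: "set A \<subseteq> M" "set B \<subseteq> M" "distinct A" "distinct B"
      using X by (auto simp: A_def B_def ball_in_def ball_out_def)
    show ?thesis unfolding bd
      by (rule split[of X D u w A B])
        (use X D_def D b(1-4) A_def B_def ps b(6)[unfolded len] dA sub less.hyps in \<open>simp_all add: of_nat_diff\<close>)
  qed
qed

text \<open>Induction with the scale \<open>j\<close> in the exponent: \<open>A\<close> has half the
  diameter and gets a smaller exponent, while \<open>B\<close> keeps the scale but loses the inner
  ball. The factor \<open>1 + \<epsilon>\<close> gained per scale is what absorbs the term
  \<open>\<epsilon> * log 2 k\<close> of the potential.\<close>

lemma build_size:
  fixes N :: nat
  assumes X: "set X \<subseteq> M" "distinct X" "X \<noteq> []" and N: "1 \<le> N" and \<epsilon>: "0 \<le> \<epsilon>" and \<gamma>: "0 \<le> \<gamma>"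
    and one: "\<And>x y. x \<in> M \<Longrightarrow> y \<in> M \<Longrightarrow> x \<noteq> y \<Longrightarrow> 1 \<le> d x y"
    and bound: "\<And>k s. 2 \<le> k \<Longrightarrow> k \<le> n \<Longrightarrow> 0 \<le> s \<Longrightarrow>
      (1 + s) ^ N * (1 + \<epsilon> * log 2 (real k)) \<le> (1 + \<epsilon>) * log 2 (real k) \<Longrightarrow> 4 * s \<le> \<gamma>"
    and n: "length X \<le> n" and j: "list_diam d X < 2 ^ j"
  shows "real (length (btree_leaves (build d (4 * N) \<epsilon> X))) \<le> real (length X) powr (1 + \<gamma> * (1 + \<epsilon>) ^ j)"
  using X N \<epsilon> n j
proof (induction X arbitrary: j rule: build_induct)
  case (single x)
  then show ?case by simp
next
  case (split X u w A B D)
  obtain x y ys where xy: "X = x # y # ys" using split(3) by (cases X rule: remdups_adj.cases) auto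
  have "1 \<le> d x y" using split(1,2) by (intro one) (auto simp: xy)
  also have "d x y \<le> D" unfolding split(4) by (rule cross_diam_ge) (auto simp: xy)
  finally have "1 \<le> D" .
  \<comment> \<open>Two distinct points are at distance at least 1, so scale 0 is
    impossible.\<close>
  then obtain i where i: "j = Suc i" using split by (cases j) auto
  define g where "g = \<gamma> * (1 + \<epsilon>) ^ i"
  define g' where "g' = g * (1 + \<epsilon>)"
  define k where "k = real (length X)"
  define a where "a = real (length A)"
  define b where "b = real (length B)"
  define a' where "a' = real (length X - length B)"
  have a'_eq: "a' = k - b" using split(15) by (simp add: a'_def k_def b_def of_nat_diff)
  have g0: "0 \<le> g" "\<gamma> \<le> g" using \<gamma> \<epsilon> mult_left_mono[of 1 "(1 + \<epsilon>) ^ i" \<gamma>] by (auto simp: g_def one_le_power)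
  have g': "0 \<le> g'" using g0 \<epsilon> by (simp add: g'_def)
  have pos: "1 \<le> a" "1 \<le> b" "1 \<le> a'" "2 * a \<le> k" "b \<le> k"
  proof -
    show "1 \<le> a" "1 \<le> b" using split(10,11) by (simp_all add: a_def b_def Suc_le_eq)
    show "1 \<le> a'" "b \<le> k" using split(15) by (simp_all add: a'_def k_def b_def Suc_le_eq)
    show "2 * a \<le> k" using split(13) unfolding a_def k_def by linarith
  qed
  have IHA: "real (length (btree_leaves (build d (4 * N) \<epsilon> A))) \<le> a powr (1 + g)"
    unfolding g_def a_def using split i by (intro split(17)) auto
  have "list_diam d B \<le> D" unfolding split(4) using split(9) by (intro list_diam_mono) (auto simp: ball_out_def)
  then have IHB: "real (length (btree_leaves (build d (4 * N) \<epsilon> B))) \<le> b powr (1 + g')"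
    unfolding g'_def g_def b_def using split(18)[of j] split i by (auto simp: mult_ac)
  obtain s where s: "0 \<le> s" "(1 + s) ^ N * (1 + \<epsilon> * log 2 k) \<le> (1 + \<epsilon>) * log 2 k"
      "log 2 (a / a') \<le> 4 * s * (log 2 (k / a) + \<epsilon> * log 2 k)"
    using split(14) unfolding a_def a'_def k_def by blast
  have "4 * s \<le> \<gamma>" using s(1,2) split unfolding k_def by (intro bound[of "length X"]) auto
  then have sg: "4 * s \<le> g" using g0 by simp
  have nn: "0 \<le> log 2 (k / a) + \<epsilon> * log 2 k"
    using pos \<epsilon> by (intro add_nonneg_nonneg mult_nonneg_nonneg) (auto simp: field_simps)
  have "log 2 (a / a') \<le> g * (log 2 (k / a) + \<epsilon> * log 2 k)"
    using s(3) mult_right_mono[OF sg nn] by linarith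
  \<comment> \<open>Exponentiated, this says that the leaves of \<open>A\<close> are paid for by the
    \<open>a'\<close> points of the inner ball, at \<open>k powr g'\<close> each. Together with the
    points of \<open>B\<close> these are all points of \<open>X\<close>, so the overlap of the parts
    is not counted twice.\<close>
  then have "log 2 a * (1 + g) \<le> log 2 a' + g' * log 2 k"
    using pos by (simp add: log_divide g'_def algebra_simps)
  then have "2 powr (log 2 a * (1 + g)) \<le> 2 powr (log 2 a' + g' * log 2 k)" by simp
  moreover have "2 powr (log 2 a * (1 + g)) = a powr (1 + g)"
    using pos by (simp flip: powr_powr)
  moreover have "2 powr (log 2 a' + g' * log 2 k) = a' * k powr g'"
    using pos by (simp add: powr_add mult.commute[of g'] flip: powr_powr)
  ultimately have A: "a powr (1 + g) \<le> a' * k powr g'" by simp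
  have "b powr (1 + g') = b * b powr g'" using pos by (simp add: powr_add)
  also have "\<dots> \<le> b * k powr g'" using pos g' by (intro mult_left_mono powr_mono2) auto
  finally have "a powr (1 + g) + b powr (1 + g') \<le> (a' + b) * k powr g'" using A by (simp add: algebra_simps)
  also have "\<dots> = k powr (1 + g')" using pos by (simp add: a'_eq powr_add)
  finally show ?case using IHA IHB by (simp add: k_def g'_def g_def i mult_ac)
qed

end

text \<open>Leaves are named by their position from left to right, so the multi-embedding is a
  lookup in \<open>btree_leaves\<close>, and the offset \<open>s\<close> keeps the names in
  different subtrees disjoint.\<close>

primrec number_leaves :: "nat \<Rightarrow> 'a btree \<Rightarrow> nat ltree" where
  "number_leaves s (Tip x) = Leaf s"
| "number_leaves s (Br D l r) = Node D [number_leaves s l, number_leaves (s + length (btree_leaves l)) r]"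

lemma leaves_number_leaves: "leaves (number_leaves s T) = [s..<s + length (btree_leaves T)]"
proof (induction T arbitrary: s)
  case (Br D l r)
  then show ?case
    using upt_add_eq_append[of s "s + length (btree_leaves l)" "length (btree_leaves r)"] by (simp add: add.assoc)
qed simp

lemma tree_dist_Node_pair:
  "tree_dist (Node D [T1, T2]) x y =
     (if x \<in> set (leaves T1) \<and> y \<in> set (leaves T1) then tree_dist T1 x y
      else if x \<in> set (leaves T2) \<and> y \<in> set (leaves T2) then tree_dist T2 x y else D)"
  by (simp add: tree_dist_def)

lemma tree_dist_le_label: "wf_labels T \<Longrightarrow> tree_dist T x y \<le> label T"
proof (induction T x y rule: lca.induct)
  case (1 p x y)
  then show ?case by (simp add: tree_dist_def)
next
  case (2 D ts x y)
  show ?case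
  proof (cases "find (\<lambda>s. x \<in> set (leaves s) \<and> y \<in> set (leaves s)) ts")
    case None
    then show ?thesis by (simp add: tree_dist_def)
  next
    case (Some s)
    then have "s \<in> set ts" by (auto simp: find_Some_iff)
    then have "tree_dist s x y \<le> label s" "label s \<le> D" using 2 Some by auto
    then show ?thesis using Some by (simp add: tree_dist_def)
  qed
qed

text \<open>Transfers a lifting from the distance of a subtree to that of the whole tree, which
  agrees with it on the leaves of the subtree.\<close>

lemma liftable_cong:
  assumes "liftable \<rho> N F \<alpha> d p" "\<And>x y. x \<in> N \<Longrightarrow> y \<in> N \<Longrightarrow> \<rho>' x y = \<rho> x y"
  shows "liftable \<rho>' N F \<alpha> d p"
proof -
  obtain p' where p': "set p' \<subseteq> N" "map F p' = p" "path_length \<rho> p' \<le> \<alpha> * path_length d p"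
    using assms(1) unfolding liftable_def by blast
  have "path_length \<rho>' p' = path_length \<rho> p'"
    unfolding path_length_def
  proof (rule sum.cong)
    fix i assume "i \<in> {..<length p' - 1}"
    then have "p' ! i \<in> set p'" "p' ! Suc i \<in> set p'" by auto
    then show "\<rho>' (p' ! i) (p' ! Suc i) = \<rho> (p' ! i) (p' ! Suc i)" using p'(1) by (intro assms(2)) auto
  qed simp
  then show ?thesis unfolding liftable_def using p' by (intro exI[of _ p']) simp
qed

lemma enc_output_number_leaves:
  assumes "\<And>i. i < length (btree_leaves T) \<Longrightarrow> f (s + i) = Some (btree_leaves T ! i)"
  shows "enc_output xs f (number_leaves s T) = enc_btree (\<lambda>x. real (index_of xs x)) T"
  using assms
proof (induction T arbitrary: s)
  case (Tip x)
  then show ?case using Tip[of 0] by simp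
next
  case (Br D l r)
  have "f (s + i) = Some (btree_leaves l ! i)" if "i < length (btree_leaves l)" for i
    using Br.prems[of i] that by (simp add: nth_append)
  moreover have "f (s + length (btree_leaves l) + i) = Some (btree_leaves r ! i)" if "i < length (btree_leaves r)" for i
    using Br.prems[of "length (btree_leaves l) + i"] that by (simp add: nth_append add.assoc)
  ultimately show ?case using Br.IH by simp
qed

context Metric_space
begin

text \<open>The outer ball contains the inner one, so the two parts cover \<open>X\<close>.\<close>

lemma set_btree_leaves_build:
  fixes N :: nat
  assumes X: "set X \<subseteq> M" "distinct X" "X \<noteq> []" and N: "1 \<le> N" and \<epsilon>: "0 \<le> \<epsilon>"
  shows "set (btree_leaves (build d (4 * N) \<epsilon> X)) = set X"
  using assms
proof (induction X rule: build_induct)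
  case (split X u w A B D)
  then show ?case by (auto simp: ball_in_def ball_out_def add_increasing2)
qed simp

lemma wf_labels_build:
  fixes N :: nat
  assumes X: "set X \<subseteq> M" "distinct X" "X \<noteq> []" and N: "1 \<le> N" and \<epsilon>: "0 \<le> \<epsilon>"
  shows "wf_labels (number_leaves s (build d (4 * N) \<epsilon> X)) \<and>
    label (number_leaves s (build d (4 * N) \<epsilon> X)) = list_diam d X"
  using assms
proof (induction X arbitrary: s rule: build_induct)
  case (single x)
  then show ?case by (simp add: cross_diam_def eccentricity_def)
next
  case (split X u w A B D)
  have "list_diam d B \<le> D" "list_diam d A \<le> D"
    unfolding split(4) using split(8,9) by (auto intro!: list_diam_mono simp: ball_in_def ball_out_def)
  then show ?case using split by simp
qed

text \<open>Leaves that are separated at a vertex get its label as their distance, and this label is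
  the diameter of a set containing both images.\<close>

lemma build_non_contractive:
  fixes N :: nat
  assumes X: "set X \<subseteq> M" "distinct X" "X \<noteq> []" and N: "1 \<le> N" and \<epsilon>: "0 \<le> \<epsilon>"
    and F: "\<And>i. i < length (btree_leaves (build d (4 * N) \<epsilon> X)) \<Longrightarrow> F (s + i) = btree_leaves (build d (4 * N) \<epsilon> X) ! i"
    and xy: "x \<in> set (leaves (number_leaves s (build d (4 * N) \<epsilon> X)))" "y \<in> set (leaves (number_leaves s (build d (4 * N) \<epsilon> X)))"
  shows "d (F x) (F y) \<le> tree_dist (number_leaves s (build d (4 * N) \<epsilon> X)) x y"
  using assms
proof (induction X arbitrary: s rule: build_induct)
  case (single z)
  then have "F s = z" using single.prems(1)[of 0] by simp
  then show ?case using single by (simp add: tree_dist_def)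
next
  case (split X u w A B D)
  let ?TA = "build d (4 * N) \<epsilon> A" and ?TB = "build d (4 * N) \<epsilon> B"
  have FA: "F (s + i) = btree_leaves ?TA ! i" if "i < length (btree_leaves ?TA)" for i
    using split.prems(1)[of i] that by (simp add: nth_append)
  have FB: "F (s + length (btree_leaves ?TA) + i) = btree_leaves ?TB ! i" if "i < length (btree_leaves ?TB)" for i
    using split.prems(1)[of "length (btree_leaves ?TA) + i"] that by (simp add: nth_append add.assoc)
  have FX: "F z \<in> set X" if "z \<in> set (leaves (number_leaves s (Br D ?TA ?TB)))" for z
  proof -
    have z: "s \<le> z" "z < s + length (btree_leaves (Br D ?TA ?TB))"
      using that unfolding leaves_number_leaves by simp_all
    define i where "i = z - s"
    have i: "z = s + i" "i < length (btree_leaves (Br D ?TA ?TB))"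
      using z by (simp_all add: i_def)
    then have "F z \<in> set (btree_leaves (Br D ?TA ?TB))" using split.prems(1)[of i] nth_mem[OF i(2)] by simp
    moreover have sub: "set A \<subseteq> M" "distinct A" "set B \<subseteq> M" "distinct B"
      using split(1,2,8,9) by (auto simp: ball_in_def ball_out_def)
    note set_btree_leaves_build[OF sub(1,2) split(10) N \<epsilon>] set_btree_leaves_build[OF sub(3,4) split(11) N \<epsilon>]
    ultimately show ?thesis using split(8,9) by (auto simp: ball_in_def ball_out_def)
  qed
  have "d (F x) (F y) \<le> D" unfolding split(4) using FX split.prems by (intro cross_diam_ge) auto
  moreover note split(17)[of s, OF FA] split(18)[of "s + length (btree_leaves ?TA)", OF FB]
  ultimately show ?case by (simp add: tree_dist_Node_pair)
qed

text \<open>\<open>A\<close> halves both the size and the diameter and hence lowers \<open>j\<close>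
  by 1, whichever alternative of the assumption holds; \<open>B\<close> keeps \<open>j\<close>. So
  \<open>8 * N\<close> is added once per halving.\<close>

lemma build_lift:
  fixes N :: nat
  assumes X: "set X \<subseteq> M" "distinct X" "X \<noteq> []" and N: "1 \<le> N" and \<epsilon>: "0 \<le> \<epsilon>"
    and one: "\<And>x y. x \<in> M \<Longrightarrow> y \<in> M \<Longrightarrow> x \<noteq> y \<Longrightarrow> 1 \<le> d x y"
    and j: "length X < 2 ^ Suc j \<or> list_diam d X < 2 ^ j"
    and F: "\<And>i. i < length (btree_leaves (build d (4 * N) \<epsilon> X)) \<Longrightarrow> F (s + i) = btree_leaves (build d (4 * N) \<epsilon> X) ! i"
    and p: "set p \<subseteq> set X"
  shows "liftable (tree_dist (number_leaves s (build d (4 * N) \<epsilon> X)))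
    (set (leaves (number_leaves s (build d (4 * N) \<epsilon> X)))) F (8 * N * j) d p"
  using X N \<epsilon> j F p
proof (induction X arbitrary: s j p rule: build_induct)
  case (single x)
  have "map F (replicate (length p) s) = p"
    using single.prems(2)[of 0] single.prems(3) by (auto simp: map_replicate_const intro!: replicate_length_same)
  moreover have "path_length (tree_dist (Leaf s)) q = 0" for q
    by (simp add: path_length_def tree_dist_def)
  ultimately show ?case unfolding liftable_def using path_length_nonneg[of p]
    by (intro exI[of _ "replicate (length p) s"]) auto
next
  case (split X u w A B D)
  let ?TA = "build d (4 * N) \<epsilon> A" and ?TB = "build d (4 * N) \<epsilon> B"
  let ?LA = "number_leaves s ?TA" and ?LB = "number_leaves (s + length (btree_leaves ?TA)) ?TB"
  let ?\<rho> = "tree_dist (Node D [?LA, ?LB])"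
  obtain x y ys where xy: "X = x # y # ys" using split(3) by (cases X rule: remdups_adj.cases) auto
  have "1 \<le> d x y" using split(1,2) by (intro one) (auto simp: xy)
  also have "d x y \<le> D" unfolding split(4) by (rule cross_diam_ge) (auto simp: xy)
  finally have D1: "1 \<le> D" .
  \<comment> \<open>For \<open>j = 0\<close> the assumption would leave fewer than 2 points or a
    diameter below 1; this is why the size is compared with the exponent
    \<open>Suc j\<close>.\<close>
  then obtain i where i: "j = Suc i" using split(3,4) split.prems(1) by (cases j) auto
  have FA: "F (s + i) = btree_leaves ?TA ! i" if "i < length (btree_leaves ?TA)" for i
    using split.prems(2)[of i] that by (simp add: nth_append)
  have FB: "F (s + length (btree_leaves ?TA) + i) = btree_leaves ?TB ! i" if "i < length (btree_leaves ?TB)" for i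
    using split.prems(2)[of "length (btree_leaves ?TA) + i"] that by (simp add: nth_append add.assoc)
  have disj: "set (leaves ?LA) \<inter> set (leaves ?LB) = {}" by (auto simp: leaves_number_leaves)
  have jA: "length A < 2 ^ Suc i \<or> list_diam d A < 2 ^ i"
    using split.prems(1) split(4,13,16) by (auto simp: i)
  have "list_diam d B \<le> D" unfolding split(4) using split(9) by (intro list_diam_mono) (auto simp: ball_out_def)
  then have jB: "length B < 2 ^ Suc j \<or> list_diam d B < 2 ^ j"
    using split.prems(1) split(4,15) by auto
  have liftA: "liftable ?\<rho> (set (leaves ?LA)) F (8 * N * i) d q" if "set q \<subseteq> set A" for q
    by (rule liftable_cong[OF split(17)[OF jA FA that]]) (auto simp: tree_dist_Node_pair)
  have liftB: "liftable ?\<rho> (set (leaves ?LB)) F (8 * N * j) d q" if "set q \<subseteq> set B" for q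
    by (rule liftable_cong[OF split(18)[OF jB FB that]]) (use disj in \<open>auto simp: tree_dist_Node_pair\<close>)
  have "set A \<subseteq> M" "distinct A" "set B \<subseteq> M" "distinct B"
    using split(1,2,8,9) by (auto simp: ball_in_def ball_out_def)
  note wfA = wf_labels_build[OF this(1,2) split(10) N \<epsilon>, of s]
    and wfB = wf_labels_build[OF this(3,4) split(11) N \<epsilon>, of "s + length (btree_leaves ?TA)"]
  have "wf_labels (Node D [?LA, ?LB])"
    using wfA wfB split(5,16) \<open>list_diam d B \<le> D\<close> by simp
  then have \<rho>: "?\<rho> z z' \<le> D" for z z' using tree_dist_le_label by fastforce
  have "liftable ?\<rho> (set (leaves ?LA) \<union> set (leaves ?LB)) F (real (8 * N * i) + 8 * N) d p"
  \<comment> \<open>The value \<open>8 * N\<close> for \<open>\<sigma>\<close> is forced: times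
    \<open>\<delta> = D / (4 * N)\<close> it gives exactly 2 D.\<close>
  proof (rule liftable_split[where r = "d u w" and \<delta> = "D / (4 * N)" and D = D and X = "set X" and u = u])
    show "liftable ?\<rho> (set (leaves ?LA)) F (8 * N * i) d q"
      if "set q \<subseteq> {x \<in> set X. d u x \<le> d u w + D / (4 * N)}" for q
      using that by (intro liftA) (auto simp: split(8) ball_in_def)
    have "real (8 * N * j) = real (8 * N * i) + 8 * N" by (simp add: i algebra_simps)
    then show "liftable ?\<rho> (set (leaves ?LB)) F (real (8 * N * i) + 8 * N) d q"
      if "set q \<subseteq> {x \<in> set X. \<not> d u x \<le> d u w}" for q
      using liftB[of q] that by (auto simp: split(9) ball_out_def)
  qed (use split \<rho> D1 N in auto)
  moreover have "real (8 * N * i) + 8 * N = real (8 * N * j)" by (simp add: i algebra_simps)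
  ultimately show ?case by simp
qed

end

section \<open>Assembling the bounds\<close>

text \<open>The first argument of \<open>node_cost\<close> is the cost of a distance lookup in the
  matrix. The number of leaves is at least that of points, so everything is bounded by a power of
  \<open>L\<close>.\<close>

lemma node_cost_poly: "\<exists>c. \<forall>n L. 2 \<le> n \<longrightarrow> n \<le> L \<longrightarrow> 2 * L * node_cost (20 * (n + 1) + 20) n \<le> c * L ^ c"
proof -
  have "2 * L * node_cost (20 * (n + 1) + 20) n \<le> 8680 * L ^ 5" if n: "2 \<le> n" "n \<le> L" for n L
  proof -
    have L: "2 \<le> L" using n by simp
    define c where "c = 20 * (n + 1) + 20"
    have P: "1 \<le> L" "L \<le> L ^ 4" "L ^ 2 \<le> L ^ 4" "L ^ 3 \<le> L ^ 4" "1 \<le> L ^ 4" "1 \<le> L ^ 2" "L \<le> L ^ 2"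
      using L power_increasing[of _ _ L] by (auto intro: self_le_power)
    have c: "c + 40 \<le> 60 * L" "c \<le> 60 * L" using n L by (auto simp: c_def)
    have n1: "n + 1 \<le> 2 * L" "n + 2 \<le> 2 * L" using n L by auto
    have "score_cost c n \<le> 3 * (60 * L) * (2 * L) + 90 * (2 * L) + 200"
      unfolding score_cost_def using c n1 by (intro add_mono mult_mono) auto
    also have "\<dots> + 150 \<le> 900 * L ^ 2" using P(7) mult_le_mono[OF L L] unfolding power2_eq_square by linarith
    finally have s: "score_cost c n + 150 \<le> 900 * L ^ 2" by simp
    have "node_cost c n \<le> 60 * L * (2 * L) * (2 * L) + 900 * L ^ 2 * (2 * L) * (2 * L) + 60 * L
        + 2 * (60 * L * (2 * L)) + 200"
      unfolding node_cost_def using c n1 s by (intro add_mono mult_mono) auto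
    also have "\<dots> = 240 * L ^ 3 + 3600 * L ^ 4 + 60 * L + 240 * L ^ 2 + 200"
      by (simp add: power2_eq_square power3_eq_cube power4_eq_xxxx)
    also have "\<dots> \<le> 4340 * L ^ 4" using P by linarith
    finally have "2 * L * node_cost c n \<le> 2 * L * (4340 * L ^ 4)" by (rule mult_left_mono) simp
    also have "\<dots> = 8680 * L ^ 5" using power_Suc[of L 4] by simp
    finally show ?thesis by (simp add: c_def)
  qed
  note poly = this
  \<comment> \<open>\<open>c\<close> is both factor and exponent; it is kept abstract so that the
    exponent is not a large numeral.\<close>
  obtain c :: nat where c: "8680 \<le> c" by blast
  have "2 * L * node_cost (20 * (n + 1) + 20) n \<le> c * L ^ c" if n: "2 \<le> n" "n \<le> L" for n L
  proof -
    have "8680 * L ^ 5 \<le> c * L ^ c" using c n by (intro mult_mono power_increasing) auto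
    with poly[OF n] show ?thesis by (rule order_trans)
  qed
  then show ?thesis by blast
qed

lemma index_of_nth: "distinct xs \<Longrightarrow> i < length xs \<Longrightarrow> index_of xs (xs ! i) = i"
proof -
  assume "distinct xs" "i < length xs"
  then have "takeWhile (\<lambda>y. y \<noteq> xs ! i) xs = take i xs"
    by (intro takeWhile_eq_take_P_nth) (auto simp: nth_eq_iff_index_eq)
  then show ?thesis using \<open>i < length xs\<close> by (simp add: index_of_def)
qed

lemma diam_eq_list_diam:
  assumes "Metric_space V d" "set xs = V" "xs \<noteq> []"
  shows "diam V d = list_diam d xs"
proof -
  interpret Metric_space V d by fact
  have fin: "finite {d x y |x y. x \<in> V \<and> y \<in> V}"
    using finite_image_set2[of "\<lambda>x. x \<in> V" "\<lambda>y. y \<in> V" d] assms(2) by auto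
  show ?thesis unfolding diam_def
  proof (rule Max_eqI[OF fin])
    show "y \<le> list_diam d xs" if "y \<in> {d x y |x y. x \<in> V \<and> y \<in> V}" for y
      using that cross_diam_ge[of _ xs _ xs d] assms(2) by auto
    show "list_diam d xs \<in> {d x y |x y. x \<in> V \<and> y \<in> V}"
      using cross_diam_attained[of xs xs d] assms(2,3) by auto
  qed
qed

lemma dist_ge_min_nonzero_dist:
  assumes "finite V" "x \<in> V" "y \<in> V" "d x y \<noteq> 0"
  shows "min_nonzero_dist V d \<le> d x y"
proof -
  have "finite {d x y |x y. x \<in> V \<and> y \<in> V}"
    using finite_image_set2[of "\<lambda>x. x \<in> V" "\<lambda>y. y \<in> V" d] assms(1) by auto
  then have "finite {d x y |x y. x \<in> V \<and> y \<in> V \<and> d x y \<noteq> 0}" by (rule rev_finite_subset) auto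
  then show ?thesis unfolding min_nonzero_dist_def using assms by (intro Min_le) auto
qed

text \<open>The function \<open>(1 + \<epsilon>) * x / (1 + \<epsilon> * x)\<close> increases in
  \<open>x\<close>, so \<open>k\<close> may be replaced by \<open>n\<close> before the N-th root is
  taken.\<close>

lemma growth_rate_bound:
  fixes \<epsilon> s :: real
  assumes "0 \<le> \<epsilon>" "2 \<le> k" "k \<le> n" "0 \<le> s" "1 \<le> N"
    "(1 + s) ^ N * (1 + \<epsilon> * log 2 (real k)) \<le> (1 + \<epsilon>) * log 2 (real k)"
  shows "1 + s \<le> ((1 + \<epsilon>) * log 2 (real n) / (1 + \<epsilon> * log 2 (real n))) powr (1 / real N)"
proof -
  define lk where "lk = log 2 (real k)"
  define ln where "ln = log 2 (real n)"
  have l: "1 \<le> lk" "lk \<le> ln" using assms by (auto simp: lk_def ln_def le_log_iff)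
  have pos: "0 < 1 + \<epsilon> * lk" "0 < 1 + \<epsilon> * ln" using l assms(1) by (auto intro!: add_pos_nonneg)
  have "(1 + s) ^ N \<le> (1 + \<epsilon>) * lk / (1 + \<epsilon> * lk)"
    using assms(6) pos by (simp add: lk_def pos_le_divide_eq)
  also have "\<dots> \<le> (1 + \<epsilon>) * ln / (1 + \<epsilon> * ln)"
  proof -
    have "(1 + \<epsilon>) * (lk * (1 + \<epsilon> * ln)) \<le> (1 + \<epsilon>) * (ln * (1 + \<epsilon> * lk))"
      using l assms(1) by (intro mult_left_mono) (auto simp: algebra_simps)
    then show ?thesis using pos by (simp add: pos_divide_le_eq pos_le_divide_eq mult.assoc)
  qed
  finally have "(1 + s) powr (real N) \<le> (1 + \<epsilon>) * ln / (1 + \<epsilon> * ln)" using assms(4) by (simp add: powr_realpow)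
  then have "((1 + s) powr (real N)) powr (1 / N) \<le> ((1 + \<epsilon>) * ln / (1 + \<epsilon> * ln)) powr (1 / N)"
    by (intro powr_mono2) auto
  then show ?thesis using assms(4,5) by (simp add: powr_powr ln_def)
qed


text \<open>Explains the choice N = 12 t: with 4 from the split and 3 from the scales, Bernoulli's
  inequality bounds \<open>1 + 12 * (q - 1)\<close> by the twelfth power of \<open>q\<close>, which
  is the t-th root of \<open>Q\<close>.\<close>

lemma exponent_bound:
  fixes Q q \<epsilon> :: real
  assumes t: "1 \<le> t" and Q: "1 \<le> Q" and q: "q = Q powr (1 / real (12 * t))" and e: "(1 + \<epsilon>) ^ J \<le> 3"
  shows "1 + 4 * (q - 1) * (1 + \<epsilon>) ^ J \<le> Q powr (1 / real t)"
proof -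
  have q1: "1 \<le> q" unfolding q using Q by (intro ge_one_powr_ge_zero) auto
  have "1 + 4 * (q - 1) * (1 + \<epsilon>) ^ J \<le> 1 + 4 * (q - 1) * 3"
    using e q1 by (intro add_left_mono mult_left_mono) auto
  also have "\<dots> = 1 + real 12 * (q - 1)" by simp
  also have "\<dots> \<le> (1 + (q - 1)) ^ 12" using q1 by (intro Bernoulli_inequality) auto
  also have "\<dots> = q powr (real 12)" using q1 by (subst powr_realpow) auto
  also have "\<dots> = Q powr (1 / real t)" unfolding q using t by (simp add: powr_powr)
  finally show ?thesis .
qed

lemma one_plus_inverse_power_le:
  fixes y :: real
  assumes "0 < y" "real J \<le> y"
  shows "(1 + 1 / y) ^ J \<le> 3"
proof -
  have "(1 + 1 / y) ^ J \<le> exp (1 / y) ^ J" using assms by (intro power_mono exp_ge_add_one_self) auto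
  also have "\<dots> = exp (real J / y)" by (simp flip: exp_of_nat_mult)
  also have "\<dots> \<le> exp 1" using assms by simp
  also have "\<dots> \<le> 3" by (rule exp_le)
  finally show ?thesis .
qed

lemma less_two_power_floor_log:
  assumes "1 \<le> x"
  shows "x < 2 ^ Suc (nat \<lfloor>log 2 x\<rfloor>)"
proof -
  have "log 2 x < real (Suc (nat \<lfloor>log 2 x\<rfloor>))" using assms by (simp add: of_nat_nat) linarith
  then have "x < 2 powr real (Suc (nat \<lfloor>log 2 x\<rfloor>))" using assms by (subst (asm) log_less_iff) auto
  then show ?thesis by (subst (asm) powr_realpow) auto
qed

text \<open>Bounds the number of scales by \<open>pwlog \<Delta> + 1\<close>, the reciprocal of the
  positive choice of \<open>\<epsilon>\<close>.\<close>

lemma floor_log_le_pwlog: "1 \<le> x \<Longrightarrow> real (nat \<lfloor>log 2 x\<rfloor>) \<le> pwlog x"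
proof -
  assume x: "1 \<le> x"
  have "2 ^ nat \<lfloor>log 2 x\<rfloor> = 2 powr real (nat \<lfloor>log 2 x\<rfloor>)" by (subst powr_realpow) auto
  also have "\<dots> \<le> 2 powr (log 2 x)" using x by (intro powr_mono) (auto simp: of_nat_nat)
  also have "\<dots> = x" using x by simp
  finally have "1 \<le> x / 2 ^ nat \<lfloor>log 2 x\<rfloor>" by (simp add: pos_le_divide_eq)
  then show ?thesis unfolding pwlog_def Let_def by simp
qed

text \<open>A point is its index together with its row, so a distance is one entry of a row and is
  looked up in linear time.\<close>

lemma (in Metric_space) construction_time:
  fixes t :: nat and xs :: "'a list"
  assumes xs: "set xs = M" "distinct xs" "2 \<le> length xs" and t: "1 \<le> t"
    and diam: "1 \<le> list_diam d xs"
  defines "\<epsilon> \<equiv> if list_diam d xs \<le> real (length xs) then 1 / (pwlog (list_diam d xs) + 1) else 0"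
  shows "fcall prog 0 (enc_input t d xs)
    (enc_btree (\<lambda>x. real (index_of xs x)) (build d (4 * (12 * t)) \<epsilon> xs))
    (2 * length (btree_leaves (build d (4 * (12 * t)) \<epsilon> xs)) * node_cost (20 * (length xs + 1) + 20) (length xs))"
proof -
  let ?n = "length xs"
  define row where "row x = enc_list (map (\<lambda>y. RealV (d x y)) xs)" for x
  define g where "g x = PairV (RealV (real (index_of xs x))) (row x)" for x
  have \<epsilon>0: "0 \<le> \<epsilon>" using pwlog_nonneg[OF diam] by (simp add: \<epsilon>_def)
  have N: "1 \<le> 12 * t" using t by simp
  interpret encoded_space g "\<lambda>x. real (index_of xs x)" row d M "20 * (?n + 1) + 20" "real (4 * (12 * t))" \<epsilon>
  proof
    fix x y assume xy: "x \<in> M" "y \<in> M"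
    then obtain i where i: "i < ?n" "y = xs ! i" using xs(1) by (metis in_set_conv_nth)
    have iy: "index_of xs y = i" using index_of_nth[OF xs(2) i(1)] i(2) by simp
    have nth: "fcall prog 1 (PairV (RealV (real (index_of xs y))) (row x)) (RealV (d x y)) (20 * (i + 1))"
      using fcall_nth[of i "map (\<lambda>y. RealV (d x y)) xs"] i iy by (simp add: row_def)
    show "fcall prog 2 (PairV (g x) (g y)) (RealV (d x y)) (20 * (?n + 1) + 20)"
      apply (rule fcallI) apply (unfold prog_nth dist_body_def g_def)
      by (rule evb_intros nth)+ (use i in \<open>simp_all add: length_prog\<close>)
  next
    show "0 < real (4 * (12 * t))" using t by simp
    fix X u w
    assume "set X \<subseteq> M" "distinct X" "2 \<le> length X"
      "snd (best_split (score d (real (4 * (12 * t))) \<epsilon> X (list_diam d X)) X X) = (u, w)"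
    then show "proper_split d (real (4 * (12 * t))) X u w"
      by (rule proper_split_best[OF _ _ _ N \<epsilon>0])
  qed (use \<epsilon>0 in \<open>auto simp: g_def\<close>)
  have "map (\<lambda>(j, r). PairV (RealV (real j)) r) (List.enumerate 0 (map row xs)) = map g xs"
    by (rule nth_equalityI) (auto simp: nth_enumerate_eq g_def index_of_nth[OF xs(2)])
  then have rows: "fcall prog 13 (PairV (RealV 0) (enc_list (map row xs))) (enc_list (map g xs)) (20 * (?n + 1))"
    using fcall_number_rows[of 0 "map row xs"] by simp
  have inp: "enc_input t d xs = PairV (RealV (real t)) (enc_list (map row xs))"
    by (simp add: enc_input_def row_def[abs_def])
  show ?thesis unfolding inp
    by (rule fcall_main[OF _ xs(2) _ rows diam]) (use xs in \<open>auto simp: \<epsilon>_def\<close>)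
qed

lemma efficiently_constructs_build:
  assumes run: "fcall prog 0 (enc_input t d xs) (enc_btree (\<lambda>x. real (index_of xs x)) S) k"
    and k: "k \<le> c * length (btree_leaves S) ^ c"
    and f: "\<And>i. i < length (btree_leaves S) \<Longrightarrow> f i = Some (btree_leaves S ! i)"
  shows "efficiently_constructs prog c t d xs (number_leaves 0 S) f"
proof -
  have "enc_output xs f (number_leaves 0 S) = enc_btree (\<lambda>x. real (index_of xs x)) S"
    by (rule enc_output_number_leaves) (simp add: f)
  moreover have "card (tree_points (number_leaves 0 S)) = length (btree_leaves S)"
    by (simp add: tree_points_def leaves_number_leaves)
  moreover obtain j where "j \<le> k" "eval prog [enc_input t d xs] (prog ! 0) (enc_btree (\<lambda>x. real (index_of xs x)) S) j"
    using run unfolding fcall_def evb_def by auto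
  moreover have "prog \<noteq> []" by (simp add: prog_def)
  ultimately show ?thesis unfolding efficiently_constructs_def runs_def using k by (metis le_trans)
qed

theorem theorem3p1:
  shows "\<exists>(C::real) (P::program) (c::nat).
    \<forall>(V::'a set) (d::'a \<Rightarrow> 'a \<Rightarrow> real) (n::nat) (\<Delta>::real) (t::nat) (xs::'a list).
      Metric_space V d \<and> finite V \<and> card V = n \<and> 2 \<le> n \<and>
      min_nonzero_dist V d = 1 \<and> diam V d = \<Delta> \<and> 1 \<le> t \<and>
      set xs = V \<and> distinct xs \<longrightarrow>
      (\<exists>(T::nat ltree) (f::nat \<rightharpoonup> 'a).
         ultrametric_tree T \<and>
         path_embedding V d (tree_points T) (tree_dist T) (C * distortion_order n t \<Delta>) f \<and>
         real (card (tree_points T)) \<le> real n powr size_exponent n t \<Delta> \<and>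
         efficiently_constructs P c t d xs T f)"
proof -
  obtain c :: nat where c: "\<And>n L. 2 \<le> n \<Longrightarrow> n \<le> L \<Longrightarrow> 2 * L * node_cost (20 * (n + 1) + 20) n \<le> c * L ^ c"
    using node_cost_poly by blast
  show ?thesis
  \<comment> \<open>192 = 8 * 12 * 2: the factor \<open>8 * N\<close> per scale with N = 12 t, and
    at most \<open>2 * max 1 (min (log 2 \<Delta>) log_n)\<close> scales.\<close>
  proof (rule exI[of _ 192], rule exI[of _ prog], rule exI[of _ c], intro allI impI)
    fix V :: "'a set" and d :: "'a \<Rightarrow> 'a \<Rightarrow> real" and n :: nat and \<Delta> :: real and t :: nat and xs :: "'a list"
    assume asm: "Metric_space V d \<and> finite V \<and> card V = n \<and> 2 \<le> n \<and>
      min_nonzero_dist V d = 1 \<and> diam V d = \<Delta> \<and> 1 \<le> t \<and> set xs = V \<and> distinct xs"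
    then interpret Metric_space V d by simp
    have t: "1 \<le> t" and n: "2 \<le> n" and xs: "set xs = V" "distinct xs" and len: "length xs = n"
      using asm distinct_card[of xs] by auto
    have xs0: "xs \<noteq> []" "set xs \<subseteq> V" "2 \<le> length xs" using n len xs by auto
    have \<Delta>: "\<Delta> = list_diam d xs" using diam_eq_list_diam[of V d xs] asm xs0 by simp
    have one: "1 \<le> d x y" if "x \<in> V" "y \<in> V" "x \<noteq> y" for x y
      using dist_ge_min_nonzero_dist[of V x y d] asm that by simp
    obtain x y ys where "xs = x # y # ys" using xs0(3) by (cases xs rule: remdups_adj.cases) auto
    then have "1 \<le> d x y" "d x y \<le> list_diam d xs" using xs by (auto intro!: one cross_diam_ge)
    then have \<Delta>1: "1 \<le> \<Delta>" using \<Delta> by linarith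
    define N where "N = 12 * t"
    have N: "1 \<le> N" using t by (simp add: N_def)
    \<comment> \<open>For \<open>\<Delta> \<le> n\<close>, this \<open>\<epsilon>\<close> is small
      enough for \<open>(1 + \<epsilon>) ^ J\<close> to stay below 3 and large enough for
      \<open>Q\<close> to be of order \<open>log 2 \<Delta>\<close>. Otherwise \<open>log_n\<close>
      is the smaller logarithm, and \<open>\<epsilon> = 0\<close> yields it as
      \<open>Q\<close>.\<close>
    define \<epsilon> where "\<epsilon> = (if \<Delta> \<le> real n then 1 / (pwlog \<Delta> + 1) else 0)"
    have \<epsilon>: "0 \<le> \<epsilon>" using pwlog_nonneg[OF \<Delta>1] by (simp add: \<epsilon>_def)
    define S where "S = build d (4 * N) \<epsilon> xs"
    define L where "L = length (btree_leaves S)"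
    define T where "T = number_leaves 0 S"
    define F where "F i = btree_leaves S ! i" for i
    define f where "f i = (if i < L then Some (F i) else None)" for i
    have pts: "tree_points T = {..<L}" by (auto simp: tree_points_def T_def leaves_number_leaves L_def)
    have setS: "set (btree_leaves S) = V"
      unfolding S_def using set_btree_leaves_build[OF xs0(2) xs(2) xs0(1) N \<epsilon>] xs by simp
    have nL: "n \<le> L" using card_length[of "btree_leaves S"] asm by (simp add: setS L_def)
    define log_n where "log_n = log 2 (real n)"
    have ln1: "1 \<le> log_n" using n by (simp add: log_n_def le_log_iff)
    have l\<Delta>: "log 2 (4 * \<Delta>) = 2 + log 2 \<Delta>" "0 \<le> log 2 \<Delta>" using \<Delta>1 log_mult[of 2 4 \<Delta>] log_nat_power[of 2 2 2] by auto
    \<comment> \<open>\<open>Q\<close> bounds the total decrease of the potential over all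
      layers.\<close>
    define Q where "Q = (1 + \<epsilon>) * log_n / (1 + \<epsilon> * log_n)"
    have pos: "0 < 1 + \<epsilon> * log_n" using \<epsilon> ln1 by (auto intro!: add_pos_nonneg)
    have Q1: "1 \<le> Q" using pos ln1 by (simp add: Q_def pos_le_divide_eq algebra_simps)
    have Q_n: "Q \<le> log_n"
    proof -
      have "(1 + \<epsilon>) * log_n \<le> (1 + \<epsilon> * log_n) * log_n"
        using ln1 \<epsilon> mult_left_mono[of 1 log_n \<epsilon>] by (intro mult_right_mono) auto
      then show ?thesis using pos by (simp add: Q_def pos_divide_le_eq mult.commute)
    qed
    \<comment> \<open>Both cases bound \<open>Q\<close> by \<open>log 2 (4 * \<Delta>)\<close>
      itself, which is at least 2; squaring weakens this to the form of
      \<open>size_exponent\<close>.\<close>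
    have Q_\<Delta>: "Q \<le> log 2 (4 * \<Delta>) ^ 2"
    proof (cases "\<Delta> \<le> real n")
      case True
      have p: "0 < pwlog \<Delta> + 1" using pwlog_nonneg[OF \<Delta>1] by simp
      have \<epsilon>': "\<epsilon> * (pwlog \<Delta> + 1) = 1" using p True by (simp add: \<epsilon>_def)
      have "(1 + \<epsilon>) * log_n \<le> (pwlog \<Delta> + 2) * (1 + \<epsilon> * log_n)"
      proof -
        have eq: "(pwlog \<Delta> + 2) * (1 + \<epsilon> * log_n) = (pwlog \<Delta> + 2) + (\<epsilon> * (pwlog \<Delta> + 1)) * log_n + \<epsilon> * log_n"
          by (simp add: algebra_simps)
        show ?thesis unfolding eq \<epsilon>' using p by (simp add: algebra_simps)
      qed
      then have "Q \<le> pwlog \<Delta> + 2" using pos by (simp add: Q_def pos_divide_le_eq)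
      also have "\<dots> \<le> log 2 (4 * \<Delta>)" using pwlog_le_log[OF \<Delta>1] l\<Delta> by simp
      also have "\<dots> \<le> log 2 (4 * \<Delta>) ^ 2" using l\<Delta> by (intro self_le_power) auto
      finally show ?thesis .
    next
      case False
      then have "log_n \<le> log 2 \<Delta>" using n \<Delta>1 by (simp add: log_n_def)
      then have "Q \<le> log 2 (4 * \<Delta>)" using Q_n l\<Delta> by linarith
      also have "\<dots> \<le> log 2 (4 * \<Delta>) ^ 2" using l\<Delta> by (intro self_le_power) auto
      finally show ?thesis .
    qed
    define J where "J = Suc (nat \<lfloor>log 2 \<Delta>\<rfloor>)"
    have \<Delta>J: "\<Delta> < 2 ^ J" unfolding J_def by (rule less_two_power_floor_log[OF \<Delta>1])
    have e3: "(1 + \<epsilon>) ^ J \<le> 3"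
    proof (cases "\<Delta> \<le> real n")
      case True
      then show ?thesis
        using one_plus_inverse_power_le[of "pwlog \<Delta> + 1" J] floor_log_le_pwlog[OF \<Delta>1] pwlog_nonneg[OF \<Delta>1]
        by (simp add: \<epsilon>_def J_def)
    qed (simp add: \<epsilon>_def)
    define q where "q = Q powr (1 / real N)"
    have "1 \<le> q" unfolding q_def using Q1 by (intro ge_one_powr_ge_zero) auto
    then have q: "0 \<le> 4 * (q - 1)" by simp
    have "real L \<le> real n powr (1 + 4 * (q - 1) * (1 + \<epsilon>) ^ J)"
      unfolding L_def S_def len[symmetric]
    proof (rule build_size[OF xs0(2) xs(2) xs0(1) N \<epsilon> q one])
      fix k s assume "2 \<le> k" "k \<le> length xs" "0 \<le> s"
        "(1 + s) ^ N * (1 + \<epsilon> * log 2 (real k)) \<le> (1 + \<epsilon>) * log 2 (real k)"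
      then have "1 + s \<le> q"
        using growth_rate_bound[OF \<epsilon>, of k n s N] N unfolding q_def Q_def log_n_def len by blast
      then show "4 * s \<le> 4 * (q - 1)" by simp
    qed (use \<Delta>J \<Delta> in auto)
    also have "\<dots> \<le> real n powr (Q powr (1 / real t))"
      using n exponent_bound[OF t Q1 _ e3, of q] by (intro powr_mono) (auto simp: q_def N_def)
    also have "\<dots> \<le> real n powr size_exponent n t \<Delta>"
    proof (intro powr_mono)
      have "Q powr (1 / real t) \<le> log_n powr (1 / real t)" using Q_n Q1 by (intro powr_mono2) auto
      moreover have "Q powr (1 / real t) \<le> (real t * log 2 (4 * \<Delta>)) powr (2 / real t)"
      proof -
        have lt: "log 2 (4 * \<Delta>) \<le> real t * log 2 (4 * \<Delta>)" using t l\<Delta> by (simp add: mult_le_cancel_right1)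
        have "Q \<le> (real t * log 2 (4 * \<Delta>)) ^ 2"
          by (rule order_trans[OF Q_\<Delta> power_mono[OF lt]]) (use l\<Delta> in simp)
        then have "Q powr (1 / real t) \<le> ((real t * log 2 (4 * \<Delta>)) ^ 2) powr (1 / real t)"
          using Q1 by (intro powr_mono2) auto
        also have "(real t * log 2 (4 * \<Delta>)) ^ 2 = (real t * log 2 (4 * \<Delta>)) powr 2"
          using t l\<Delta> by (subst powr_numeral) auto
        also have "\<dots> powr (1 / real t) = (real t * log 2 (4 * \<Delta>)) powr (2 / real t)" by (simp add: powr_powr)
        finally show ?thesis .
      qed
      ultimately show "Q powr (1 / real t) \<le> size_exponent n t \<Delta>" by (simp add: size_exponent_def log_n_def)
    qed (use n in simp)
    finally have size: "real (card (tree_points T)) \<le> real n powr size_exponent n t \<Delta>" by (simp add: pts)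
    have ultra: "ultrametric_tree T"
      using wf_labels_build[OF xs0(2) xs(2) xs0(1) N \<epsilon>, of 0]
      by (simp add: ultrametric_tree_def T_def S_def leaves_number_leaves)
    \<comment> \<open>The number of scales is counted by size or by diameter, according to which
      logarithm is smaller.\<close>
    define j where "j = (if log_n \<le> log 2 \<Delta> then nat \<lfloor>log_n\<rfloor> else J)"
    have j: "length xs < 2 ^ Suc j \<or> list_diam d xs < 2 ^ j"
    proof (cases "log_n \<le> log 2 \<Delta>")
      case True
      have "real n < 2 ^ Suc (nat \<lfloor>log 2 (real n)\<rfloor>)" using n by (intro less_two_power_floor_log) auto
      then have "real n < real (2 ^ Suc j)" using True by (simp add: j_def log_n_def)
      then show ?thesis unfolding of_nat_less_iff len by blast
    qed (use \<Delta>J \<Delta> in \<open>simp add: j_def\<close>)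
    \<comment> \<open>\<open>J\<close> may exceed \<open>log 2 \<Delta>\<close> by 1, which the
      factor 2 and \<open>max 1\<close> absorb.\<close>
    have j2: "real j \<le> 2 * max 1 (min (log 2 \<Delta>) log_n)"
      using ln1 l\<Delta> by (auto simp: j_def J_def of_nat_nat min_def max_def) linarith+
    have \<alpha>: "real (8 * N * j) \<le> 192 * distortion_order n t \<Delta>"
    proof -
      have "real (8 * N * j) = 96 * (real t * real j)" by (simp add: N_def)
      also have "\<dots> \<le> 96 * (real t * (2 * max 1 (min (log 2 \<Delta>) log_n)))"
        using j2 by (intro mult_left_mono) auto
      finally show ?thesis by (simp add: distortion_order_def log_n_def)
    qed
    have emb: "path_embedding V d (tree_points T) (tree_dist T) (192 * distortion_order n t \<Delta>) f"
      unfolding path_embedding_def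
    proof (intro conjI)
      have domf: "dom f = {..<L}" by (auto simp: f_def dom_def split: if_splits)
      have "ran f = set (btree_leaves S)"
        unfolding set_conv_nth by (auto simp: ran_def f_def F_def L_def split: if_splits)
      then show "multi_embedding V (tree_points T) f" by (simp add: multi_embedding_def domf pts setS)
      show "non_contractive d (tree_dist T) f" unfolding non_contractive_def
      proof (intro ballI)
        fix a b assume "a \<in> dom f" "b \<in> dom f"
        then have ab: "a < L" "b < L" by (auto simp: domf)
        have "d (F a) (F b) \<le> tree_dist T a b"
          unfolding T_def S_def
          by (rule build_non_contractive[OF xs0(2) xs(2) xs0(1) N \<epsilon>])
            (use ab in \<open>auto simp: F_def S_def leaves_number_leaves L_def\<close>)
        then show "d (the (f a)) (the (f b)) \<le> tree_dist T a b" using ab by (simp add: f_def)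
      qed
      show "path_distortion_le V d (tree_points T) (tree_dist T) f (192 * distortion_order n t \<Delta>)"
        unfolding path_distortion_le_def
      proof (intro allI impI)
        fix p assume p: "set p \<subseteq> V"
        have "liftable (tree_dist T) (tree_points T) F (8 * N * j) d p"
          unfolding T_def S_def tree_points_def
          by (rule build_lift[OF xs0(2) xs(2) xs0(1) N \<epsilon> one j]) (use p xs in \<open>auto simp: F_def S_def\<close>)
        then obtain p' where p': "set p' \<subseteq> tree_points T" "map F p' = p"
            "path_length (tree_dist T) p' \<le> real (8 * N * j) * path_length d p"
          unfolding liftable_def by blast
        have "path_length (tree_dist T) p' \<le> 192 * distortion_order n t \<Delta> * path_length d p"
          by (rule order_trans[OF p'(3) mult_right_mono[OF \<alpha> path_length_nonneg]])
        moreover have "f (p' ! i) = Some (p ! i)" if "i < length p" for i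
        proof -
          have il: "i < length p'" using that p'(2) by auto
          then have "p' ! i < L" using subsetD[OF p'(1) nth_mem[OF il]] by (simp add: pts)
          then show ?thesis using p'(2) il by (auto simp: f_def)
        qed
        ultimately show "\<exists>p'. set p' \<subseteq> tree_points T \<and> length p' = length p \<and>
            (\<forall>i<length p. f (p' ! i) = Some (p ! i)) \<and>
            path_length (tree_dist T) p' \<le> 192 * distortion_order n t \<Delta> * path_length d p"
          using p'(1,2) by (intro exI[of _ p']) auto
      qed
    qed
    have "fcall prog 0 (enc_input t d xs) (enc_btree (\<lambda>x. real (index_of xs x)) S)
        (2 * L * node_cost (20 * (n + 1) + 20) n)"
      using construction_time[OF xs xs0(3) t] \<Delta>1 unfolding S_def L_def N_def \<epsilon>_def \<Delta> len by simp
    then have "efficiently_constructs prog c t d xs T f"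
      unfolding T_def by (rule efficiently_constructs_build)
        (use c[OF n nL] in \<open>auto simp: L_def f_def F_def\<close>)
    with ultra emb size show "\<exists>(T::nat ltree) (f::nat \<rightharpoonup> 'a). ultrametric_tree T \<and>
         path_embedding V d (tree_points T) (tree_dist T) (192 * distortion_order n t \<Delta>) f \<and>
         real (card (tree_points T)) \<le> real n powr size_exponent n t \<Delta> \<and>
         efficiently_constructs prog c t d xs T f" by blast
  qed
qed

end
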